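(* Let $V^\bullet$ be the quantum exterior algebra of the first-order differential calculus $\Omega^1_q(\mathrm{F}_3)$, with degree one basis $\{e_\gamma,f_\gamma : \gamma\in\Delta^+\}$. Order $\Delta^+$ by $\alpha_2<\alpha_1+\alpha_2<\alpha_1$. Then a full set of relations for $V^\bullet$ (that is, a set of defining relations of $V^\bullet$ as a quotient of the tensor algebra $\mathcal{T}(V^1)$) is given by the following three sets of identities: (1) for all $\beta\le\gamma$ in $\Delta^+$: $e_\gamma\wedge e_\beta=-q^{(\beta,\gamma)}e_\beta\wedge e_\gamma$ and $f_\gamma\wedge f_\beta=-q^{-(\beta,\gamma)}f_\beta\wedge f_\gamma$; (2) for all $\beta\ne\gamma$ in $\Delta^+$, and also for $\beta=\gamma=\alpha_1+\alpha_2$: $e_\gamma\wedge f_\beta=-q^{(\beta,\gamma)}f_\beta\wedge e_\gamma$; (3) $e_{\alpha_1}\wedge f_{\alpha_1}=-q^2f_{\alpha_1}\wedge e_{\alpha_1}-\nu f_{\alpha_1+\alpha_2}\wedge e_{\alpha_1+\alpha_2}$ and $e_{\alpha_2}\wedge f_{\alpha_2}=-q^2f_{\alpha_2}\wedge e_{\alpha_2}+\nu f_{\alpha_1+\alpha_2}\wedge e_{\alpha_1+\alpha_2}$.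
   Context: Let $q\in\mathbb{R}\setminus\{-1,0,1\}$, $\nu:=q-q^{-1}$. Let $\Delta^+=\{\alpha_1,\alpha_2,\alpha_1+\alpha_2\}$ be the positive roots of $\mathfrak{sl}_3$, with form $(\alpha_i,\alpha_j)=a_{ij}$, $a_{11}=a_{22}=2$, $a_{12}=a_{21}=-1$. $U_q(\mathfrak{sl}_3)$ is the complex algebra generated by $E_i,F_i,K_i^{\pm1}$ ($i=1,2$) with $K_iK_j=K_jK_i$, $K_iE_j=q^{a_{ij}}E_jK_i$, $K_iF_j=q^{-a_{ij}}F_jK_i$, $[E_i,F_j]=\delta_{ij}\frac{K_i-K_i^{-1}}{q-q^{-1}}$, and $E_i^2E_j-(q+q^{-1})E_iE_jE_i+E_jE_i^2=0$, $F_i^2F_j-(q+q^{-1})F_iF_jF_i+F_jF_i^2=0$ for $i\ne j$. It is a Hopf $*$-algebra with $\Delta(E_i)=E_i\otimes K_i+1\otimes E_i$, $\Delta(F_i)=F_i\otimes1+K_i^{-1}\otimes F_i$, $\Delta(K_i)=K_i\otimes K_i$, $\varepsilon(E_i)=\varepsilon(F_i)=0$, $\varepsilon(K_i)=1$, $E_i^*=K_iF_i$, $F_i^*=E_iK_i^{-1}$, $K_i^*=K_i$. $A:=\mathcal{O}_q(\mathrm{SU}_3)$ is the Hopf subalgebra of the Hopf dual of $U_q(\mathfrak{sl}_3)$ generated by $u_{ij}$ ($1\le i,j\le3$), where $\Delta(u_{ij})=\sum_a u_{ia}\otimes u_{aj}$ and the only nonzero pairings of the $u_{ij}$ with the generators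 are $\langle E_1,u_{21}\rangle=\langle E_2,u_{32}\rangle=\langle F_1,u_{12}\rangle=\langle F_2,u_{23}\rangle=1$, $\langle K_i^{\pm1},u_{jj}\rangle=q^{\pm(\delta_{i,j-1}-\delta_{ij})}$. It is a Hopf $*$-algebra with $u_{ij}^*=S(u_{ji})$. Put $X\triangleright a:=a_{(1)}\langle X,a_{(2)}\rangle$. Then $B:=\mathcal{O}_q(\mathrm{F}_3):=\{b\in A: K_i^{\pm1}\triangleright b=b,\ i=1,2\}$. Put $E_{\alpha_i}:=E_i$, $E_{\alpha_1+\alpha_2}:=E_2E_1-q^{-1}E_1E_2$, $F_\gamma:=E_\gamma^*$, and $T:=\mathrm{span}_{\mathbb{C}}\{E_\gamma,F_\gamma:\gamma\in\Delta^+\}$. $T$ defines the left $A$-covariant first-order differential calculus $\Omega^1_q(\mathrm{SU}_3)=A\otimes\Lambda^1$ over $A$: $\Lambda^1:=A^+/\{y\in A^+:X(y)=0\ \forall X\in T\}$ (with $A^+=\ker\varepsilon$) is a right $A$-module with basis $\{e_\gamma,f_\gamma\}$ dual to $\{E_\gamma,F_\gamma\}$, the bimodule structure is $a(b\otimes v)c=abc_{(1)}\otimes vc_{(2)}$, and $\mathrm{d}a=\sum_\gamma (E_\gamma\triangleright a)\otimes e_\gamma+(F_\gamma\triangleright a)\otimes f_\gamma$. $\Omega^1_q(\mathrm{F}_3)$ is its restriction to $B$ (the $B$-sub-bimodule generated by $\mathrm{d}b$, $b\in B$). With $I:=\{y\in B^+:X(y)=0\ \forall X\in T\}$ its cotangent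 space is $V^1:=B^+/I$, identified with $\Lambda^1$ via $[b]\mapsto[b]$ (this is an isomorphism). For $a\in A$ write $a^+:=a-\varepsilon(a)1$. The quantum exterior algebra is $V^\bullet:=\mathcal{T}(V^1)/\langle I^{(2)}\rangle$, where $I^{(2)}:=\{[y_{(1)}^+]\otimes[y_{(2)}^+]:y\in I\}\subseteq V^1\otimes V^1$; its product is written $\wedge$. (It is the image, under Takeuchi's equivalence $\Omega\mapsto \Omega/B^+\Omega$, of the maximal prolongation of $\Omega^1_q(\mathrm{F}_3)$.) *)

theory Defs
  imports
    Complex_Main
    "HOL-Library.Poly_Mapping"
    "HOL-Library.Product_Plus"
    "HOL-Algebra.QuotRing"
    "HOL-Algebra.Module"
begin

section \<open>Free algebras and tensor algebras\<close>

text \<open>The free monoid, written additively so that finitely supported functions on it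
  form the free associative unital algebra with the convolution product of
  \<^theory>\<open>HOL-Library.Poly_Mapping\<close>.\<close>

datatype 'a fword = Word (letters: "'a list")

instantiation fword :: (type) monoid_add
begin

definition "0 = Word []"
definition "v + w = Word (letters v @ letters w)"

instance
  by standard (simp_all add: zero_fword_def plus_fword_def)

end

type_synonym 'a falg = "'a fword \<Rightarrow>\<^sub>0 complex"

definition letter :: "'a \<Rightarrow> 'a falg" where
  "letter a = Poly_Mapping.single (Word [a]) 1"

definition scalar :: "complex \<Rightarrow> 'w::monoid_add \<Rightarrow>\<^sub>0 complex" where
  "scalar c = Poly_Mapping.single 0 c"

definition lin_ext :: "('v \<Rightarrow> 'w::monoid_add \<Rightarrow>\<^sub>0 complex) \<Rightarrow> ('v \<Rightarrow>\<^sub>0 complex) \<Rightarrow> 'w \<Rightarrow>\<^sub>0 complex" where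
  "lin_ext h p = (\<Sum>w\<in>Poly_Mapping.keys p. scalar (Poly_Mapping.lookup p w) * h w)"

definition free_algebra :: "'a set \<Rightarrow> 'a falg ring" where
  "free_algebra X =
    \<lparr>carrier = {p. \<forall>w\<in>Poly_Mapping.keys p. set (letters w) \<subseteq> X},
     mult = (*), one = 1, zero = 0, add = (+)\<rparr>"

text \<open>The tensor algebra of a complex vector space \<open>V\<close>: the free algebra on the underlying
  set of \<open>V\<close>, modulo the relations making \<open>V\<close> embed linearly.\<close>

definition linearity_relators :: "(complex, 'v, 'm) module_scheme \<Rightarrow> 'v falg set" where
  "linearity_relators V =
     {letter (v \<oplus>\<^bsub>V\<^esub> w) - (letter v + letter w) | v w. v \<in> carrier V \<and> w \<in> carrier V} \<union>
     {letter (c \<odot>\<^bsub>V\<^esub> v) - scalar c * letter v | c v. v \<in> carrier V}"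

definition tensor_ideal :: "(complex, 'v, 'm) module_scheme \<Rightarrow> 'v falg set" where
  "tensor_ideal V = Idl\<^bsub>free_algebra (carrier V)\<^esub> (linearity_relators V)"

definition tensor_algebra :: "(complex, 'v, 'm) module_scheme \<Rightarrow> 'v falg set ring" where
  "tensor_algebra V = free_algebra (carrier V) Quot tensor_ideal V"

definition tensor_vec :: "(complex, 'v, 'm) module_scheme \<Rightarrow> 'v \<Rightarrow> 'v falg set" where
  "tensor_vec V v = tensor_ideal V +>\<^bsub>free_algebra (carrier V)\<^esub> letter v"

definition tensor_smult ::
  "(complex, 'v, 'm) module_scheme \<Rightarrow> complex \<Rightarrow> 'v falg set \<Rightarrow> 'v falg set" where
  "tensor_smult V c x =
     (tensor_ideal V +>\<^bsub>free_algebra (carrier V)\<^esub> scalar c) \<otimes>\<^bsub>tensor_algebra V\<^esub> x"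


section \<open>Root data\<close>

datatype node = N1 | N2

fun node_index :: "node \<Rightarrow> nat" where
  "node_index N1 = 1"
| "node_index N2 = 2"

fun cartan :: "node \<Rightarrow> node \<Rightarrow> int" where
  "cartan i j = (if i = j then 2 else -1)"

datatype pos_root = Alpha1 | Alpha2 | Alpha12

fun root_coeff :: "pos_root \<Rightarrow> node \<Rightarrow> int" where
  "root_coeff Alpha1 i = (if i = N1 then 1 else 0)"
| "root_coeff Alpha2 i = (if i = N2 then 1 else 0)"
| "root_coeff Alpha12 i = 1"

definition root_form :: "pos_root \<Rightarrow> pos_root \<Rightarrow> int" where
  "root_form \<beta> \<gamma> = (\<Sum>i\<in>{N1, N2}. \<Sum>j\<in>{N1, N2}. root_coeff \<beta> i * root_coeff \<gamma> j * cartan i j)"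

text \<open>The order is \<open>\<alpha>\<^sub>2 < \<alpha>\<^sub>1 + \<alpha>\<^sub>2 < \<alpha>\<^sub>1\<close>.\<close>

fun root_rank :: "pos_root \<Rightarrow> nat" where
  "root_rank Alpha2 = 0"
| "root_rank Alpha12 = 1"
| "root_rank Alpha1 = 2"

instantiation pos_root :: linorder
begin

definition "\<beta> \<le> \<gamma> \<longleftrightarrow> root_rank \<beta> \<le> root_rank \<gamma>"
definition "\<beta> < \<gamma> \<longleftrightarrow> root_rank \<beta> < root_rank \<gamma>"

instance
proof
  fix x y :: pos_root
  show "x \<le> y \<Longrightarrow> y \<le> x \<Longrightarrow> x = y"
    by (cases x; cases y) (simp_all add: less_eq_pos_root_def)
qed (auto simp: less_eq_pos_root_def less_pos_root_def)

end


section \<open>The quantised enveloping algebra\<close>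

text \<open>Elements of \<open>U\<^sub>q(sl\<^sub>3)\<close> are represented by elements of the free algebra on the generators;
  \<open>U\<^sub>q(sl\<^sub>3)\<close> is its quotient by \<open>Uq_ideal q\<close>. The Hopf and star structure maps are
  given on the free algebra, from which they descend to the quotient.\<close>

datatype gen = GE node | GF node | GK node | GKinv node

type_synonym ualg = "gen falg"

abbreviation "E\<^sub>U i \<equiv> letter (GE i)"
abbreviation "F\<^sub>U i \<equiv> letter (GF i)"
abbreviation "K\<^sub>U i \<equiv> letter (GK i)"
abbreviation "Kinv\<^sub>U i \<equiv> letter (GKinv i)"

abbreviation qpow :: "real \<Rightarrow> int \<Rightarrow> complex" where
  "qpow q n \<equiv> complex_of_real q powi n"

abbreviation nu :: "real \<Rightarrow> complex" where
  "nu q \<equiv> complex_of_real (q - inverse q)"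

definition Uq_relators :: "real \<Rightarrow> ualg set" where
  "Uq_relators q =
     {K\<^sub>U i * Kinv\<^sub>U i - 1 | i. True} \<union>
     {Kinv\<^sub>U i * K\<^sub>U i - 1 | i. True} \<union>
     {K\<^sub>U i * K\<^sub>U j - K\<^sub>U j * K\<^sub>U i | i j. True} \<union>
     {K\<^sub>U i * E\<^sub>U j - scalar (qpow q (cartan i j)) * (E\<^sub>U j * K\<^sub>U i) | i j. True} \<union>
     {K\<^sub>U i * F\<^sub>U j - scalar (qpow q (- cartan i j)) * (F\<^sub>U j * K\<^sub>U i) | i j. True} \<union>
     {E\<^sub>U i * F\<^sub>U j - F\<^sub>U j * E\<^sub>U i
        - (if i = j then scalar (inverse (nu q)) * (K\<^sub>U i - Kinv\<^sub>U i) else 0) | i j. True} \<union>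
     {E\<^sub>U i * E\<^sub>U i * E\<^sub>U j - scalar (complex_of_real (q + inverse q)) * (E\<^sub>U i * E\<^sub>U j * E\<^sub>U i)
        + E\<^sub>U j * E\<^sub>U i * E\<^sub>U i | i j. i \<noteq> j} \<union>
     {F\<^sub>U i * F\<^sub>U i * F\<^sub>U j - scalar (complex_of_real (q + inverse q)) * (F\<^sub>U i * F\<^sub>U j * F\<^sub>U i)
        + F\<^sub>U j * F\<^sub>U i * F\<^sub>U i | i j. i \<noteq> j}"

definition Uq_ideal :: "real \<Rightarrow> ualg set" where
  "Uq_ideal q = Idl\<^bsub>free_algebra UNIV\<^esub> (Uq_relators q)"

text \<open>The tensor square of the free algebra has the pairs of words as a basis.\<close>

fun gen_coproduct :: "gen \<Rightarrow> gen fword \<times> gen fword \<Rightarrow>\<^sub>0 complex" where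
  "gen_coproduct (GE i) =
     Poly_Mapping.single (Word [GE i], Word [GK i]) 1 + Poly_Mapping.single (0, Word [GE i]) 1"
| "gen_coproduct (GF i) =
     Poly_Mapping.single (Word [GF i], 0) 1 + Poly_Mapping.single (Word [GKinv i], Word [GF i]) 1"
| "gen_coproduct (GK i) = Poly_Mapping.single (Word [GK i], Word [GK i]) 1"
| "gen_coproduct (GKinv i) = Poly_Mapping.single (Word [GKinv i], Word [GKinv i]) 1"

definition coproduct :: "ualg \<Rightarrow> gen fword \<times> gen fword \<Rightarrow>\<^sub>0 complex" where
  "coproduct = lin_ext (\<lambda>w. prod_list (map gen_coproduct (letters w)))"

fun gen_counit :: "gen \<Rightarrow> complex" where
  "gen_counit (GE i) = 0"
| "gen_counit (GF i) = 0"
| "gen_counit (GK i) = 1"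
| "gen_counit (GKinv i) = 1"

definition counit :: "ualg \<Rightarrow> complex" where
  "counit p = (\<Sum>w\<in>Poly_Mapping.keys p.
     Poly_Mapping.lookup p w * prod_list (map gen_counit (letters w)))"

text \<open>The antipode is forced by the coproduct: \<open>S(E\<^sub>i) K\<^sub>i + E\<^sub>i = 0\<close> and \<open>S(F\<^sub>i) + K\<^sub>i F\<^sub>i = 0\<close>.\<close>

fun gen_antipode :: "gen \<Rightarrow> ualg" where
  "gen_antipode (GE i) = - (E\<^sub>U i * Kinv\<^sub>U i)"
| "gen_antipode (GF i) = - (K\<^sub>U i * F\<^sub>U i)"
| "gen_antipode (GK i) = Kinv\<^sub>U i"
| "gen_antipode (GKinv i) = K\<^sub>U i"

definition antipode :: "ualg \<Rightarrow> ualg" where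
  "antipode = lin_ext (\<lambda>w. prod_list (map gen_antipode (rev (letters w))))"

fun gen_star :: "gen \<Rightarrow> ualg" where
  "gen_star (GE i) = K\<^sub>U i * F\<^sub>U i"
| "gen_star (GF i) = E\<^sub>U i * Kinv\<^sub>U i"
| "gen_star (GK i) = K\<^sub>U i"
| "gen_star (GKinv i) = Kinv\<^sub>U i"

definition star :: "ualg \<Rightarrow> ualg" where
  "star p = (\<Sum>w\<in>Poly_Mapping.keys p.
     scalar (cnj (Poly_Mapping.lookup p w)) * prod_list (map gen_star (rev (letters w))))"

fun root_E :: "real \<Rightarrow> pos_root \<Rightarrow> ualg" where
  "root_E q Alpha1 = E\<^sub>U N1"
| "root_E q Alpha2 = E\<^sub>U N2"
| "root_E q Alpha12 = E\<^sub>U N2 * E\<^sub>U N1 - scalar (qpow q (-1)) * (E\<^sub>U N1 * E\<^sub>U N2)"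

definition root_F :: "real \<Rightarrow> pos_root \<Rightarrow> ualg" where
  "root_F q \<gamma> = star (root_E q \<gamma>)"

definition tangent_space :: "real \<Rightarrow> ualg set" where
  "tangent_space q =
     {\<Sum>\<gamma>\<in>{Alpha1, Alpha2, Alpha12}. scalar (c \<gamma>) * root_E q \<gamma> + scalar (d \<gamma>) * root_F q \<gamma> | c d. True}"


section \<open>The Hopf dual and the quantum coordinate algebras\<close>

text \<open>A linear functional on \<open>U\<^sub>q(sl\<^sub>3)\<close> is a linear functional on the free algebra that
  vanishes on \<open>Uq_ideal q\<close>; the pairing of \<open>X\<close> with \<open>a\<close> is the application \<open>a X\<close>.\<close>

type_synonym functional = "ualg \<Rightarrow> complex"

definition Uq_dual :: "real \<Rightarrow> functional set" where
  "Uq_dual q = {a. (\<forall>X Y. a (X + Y) = a X + a Y) \<and> (\<forall>c X. a (scalar c * X) = c * a X) \<and>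
                   (\<forall>X\<in>Uq_ideal q. a X = 0)}"

text \<open>The list \<open>[(b\<^sub>1, c\<^sub>1), \<dots>, (b\<^sub>n, c\<^sub>n)]\<close> represents the tensor \<open>b\<^sub>1 \<otimes> c\<^sub>1 + \<dots> + b\<^sub>n \<otimes> c\<^sub>n\<close>. It
  represents the coproduct \<open>a\<^sub>(\<^sub>1\<^sub>) \<otimes> a\<^sub>(\<^sub>2\<^sub>)\<close> if \<open>a(XY) = a\<^sub>(\<^sub>1\<^sub>)(X) a\<^sub>(\<^sub>2\<^sub>)(Y)\<close>; this
  determines the tensor, because the dual tensored with itself embeds into the bilinear forms.\<close>

definition is_coproduct :: "functional \<Rightarrow> (functional \<times> functional) list \<Rightarrow> bool" where
  "is_coproduct a bs \<longleftrightarrow> (\<forall>X Y. a (X * Y) = (\<Sum>(b, c)\<leftarrow>bs. b X * c Y))"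

definition Hopf_dual :: "real \<Rightarrow> functional set" where
  "Hopf_dual q = {a \<in> Uq_dual q. \<exists>bs. set bs \<subseteq> Uq_dual q \<times> Uq_dual q \<and> is_coproduct a bs}"

definition convolution :: "functional \<Rightarrow> functional \<Rightarrow> functional" where
  "convolution a b = (\<lambda>X. \<Sum>(v, w)\<in>Poly_Mapping.keys (coproduct X).
     Poly_Mapping.lookup (coproduct X) (v, w) *
       (a (Poly_Mapping.single v 1) * b (Poly_Mapping.single w 1)))"

definition Hopf_subalgebra :: "real \<Rightarrow> functional set \<Rightarrow> bool" where
  "Hopf_subalgebra q H \<longleftrightarrow> H \<subseteq> Hopf_dual q \<and> counit \<in> H \<and>
     (\<forall>a\<in>H. \<forall>b\<in>H. (\<lambda>X. a X + b X) \<in> H) \<and> (\<forall>c. \<forall>a\<in>H. (\<lambda>X. c * a X) \<in> H) \<and>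
     (\<forall>a\<in>H. \<forall>b\<in>H. convolution a b \<in> H) \<and> (\<forall>a\<in>H. a \<circ> antipode \<in> H) \<and>
     (\<forall>a\<in>H. \<exists>bs. set bs \<subseteq> H \<times> H \<and> is_coproduct a bs)"

fun gen_u :: "real \<Rightarrow> gen \<Rightarrow> nat \<Rightarrow> nat \<Rightarrow> complex" where
  "gen_u q (GE k) i j = of_bool (i = node_index k + 1 \<and> j = node_index k)"
| "gen_u q (GF k) i j = of_bool (i = node_index k \<and> j = node_index k + 1)"
| "gen_u q (GK k) i j =
     (if i = j then qpow q (of_bool (j = node_index k + 1) - of_bool (j = node_index k)) else 0)"
| "gen_u q (GKinv k) i j =
     (if i = j then qpow q (- (of_bool (j = node_index k + 1) - of_bool (j = node_index k))) else 0)"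

text \<open>The values on products of generators are those forced by
  \<open>\<Delta>(u\<^sub>i\<^sub>j) = u\<^sub>i\<^sub>1 \<otimes> u\<^sub>1\<^sub>j + u\<^sub>i\<^sub>2 \<otimes> u\<^sub>2\<^sub>j + u\<^sub>i\<^sub>3 \<otimes> u\<^sub>3\<^sub>j\<close>.\<close>

fun word_u :: "real \<Rightarrow> gen list \<Rightarrow> nat \<Rightarrow> nat \<Rightarrow> complex" where
  "word_u q [] i j = of_bool (i = j)"
| "word_u q (g # gs) i j = (\<Sum>a\<in>{1..3}. gen_u q g i a * word_u q gs a j)"

definition u_coeff :: "real \<Rightarrow> nat \<Rightarrow> nat \<Rightarrow> functional" where
  "u_coeff q i j = (\<lambda>X. \<Sum>w\<in>Poly_Mapping.keys X. Poly_Mapping.lookup X w * word_u q (letters w) i j)"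

definition Oq_SU3 :: "real \<Rightarrow> functional set" where
  "Oq_SU3 q = \<Inter>{H. Hopf_subalgebra q H \<and> (\<forall>i\<in>{1..3}. \<forall>j\<in>{1..3}. u_coeff q i j \<in> H)}"

text \<open>\<open>(X \<triangleright> a)(Y) = a\<^sub>(\<^sub>1\<^sub>)(Y) a\<^sub>(\<^sub>2\<^sub>)(X) = a(YX)\<close>.\<close>

definition left_act :: "ualg \<Rightarrow> functional \<Rightarrow> functional" where
  "left_act X a = (\<lambda>Y. a (Y * X))"

definition Oq_F3 :: "real \<Rightarrow> functional set" where
  "Oq_F3 q = {b \<in> Oq_SU3 q. \<forall>i. left_act (K\<^sub>U i) b = b \<and> left_act (Kinv\<^sub>U i) b = b}"

text \<open>The counit and the unit of the dual are evaluation at \<open>1\<close> and the counit of \<open>U\<^sub>q(sl\<^sub>3)\<close>.\<close>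

definition augmentation :: "functional set \<Rightarrow> functional set" where
  "augmentation H = {a \<in> H. a 1 = 0}"

definition plus_part :: "functional \<Rightarrow> functional" where
  "plus_part a = (\<lambda>X. a X - a 1 * counit X)"


section \<open>The cotangent space and the quantum exterior algebra\<close>

definition tangent_annihilator :: "real \<Rightarrow> functional set \<Rightarrow> functional set" where
  "tangent_annihilator q H = {y \<in> augmentation H. \<forall>X\<in>tangent_space q. y X = 0}"

definition fcoset :: "functional \<Rightarrow> functional set \<Rightarrow> functional set" where
  "fcoset a N = {\<lambda>X. a X + n X | n. n \<in> N}"

text \<open>The quotient vector space \<open>V\<^sup>1 = B\<^sup>+ / I\<close>. The \<open>mult\<close> and \<open>one\<close> fields of the record play no
  role for a vector space.\<close>

definition cotangent_space :: "real \<Rightarrow> (complex, functional set) module" where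
  "cotangent_space q =
    \<lparr>carrier = {fcoset b (tangent_annihilator q (Oq_F3 q)) | b. b \<in> augmentation (Oq_F3 q)},
     mult = (\<lambda>_ _. undefined), one = undefined,
     zero = tangent_annihilator q (Oq_F3 q),
     add = (\<lambda>v w. {\<lambda>X. a X + b X | a b. a \<in> v \<and> b \<in> w}),
     smult = (\<lambda>c v. {\<lambda>X. c * a X + n X | a n. a \<in> v \<and> n \<in> tangent_annihilator q (Oq_F3 q)})\<rparr>"

text \<open>For \<open>a \<in> A\<^sup>+\<close>, the element of \<open>V\<^sup>1\<close> that corresponds to the class of \<open>a\<close> in \<open>\<Lambda>\<^sup>1\<close> under the
  isomorphism \<open>V\<^sup>1 \<rightarrow> \<Lambda>\<^sup>1\<close>, \<open>[b] \<mapsto> [b]\<close>: the class in \<open>B\<^sup>+ / I\<close> contained in the class of \<open>a\<close>.\<close>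

definition cotangent_class :: "real \<Rightarrow> functional \<Rightarrow> functional set" where
  "cotangent_class q a = (THE v. v \<in> carrier (cotangent_space q) \<and>
     v \<subseteq> fcoset a (tangent_annihilator q (Oq_SU3 q)))"

abbreviation TV :: "real \<Rightarrow> functional set falg set ring" where
  "TV q \<equiv> tensor_algebra (cotangent_space q)"

abbreviation TV_smult ::
  "real \<Rightarrow> complex \<Rightarrow> functional set falg set \<Rightarrow> functional set falg set" where
  "TV_smult q \<equiv> tensor_smult (cotangent_space q)"

text \<open>The basis of \<open>V\<^sup>1\<close> dual to the basis of root vectors of the tangent space, as elements of
  degree one of the tensor algebra.\<close>

definition basis_e :: "real \<Rightarrow> pos_root \<Rightarrow> functional set falg set" where
  "basis_e q \<gamma> = tensor_vec (cotangent_space q) (THE v. v \<in> carrier (cotangent_space q) \<and>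
     (\<forall>y\<in>v. \<forall>\<delta>. y (root_E q \<delta>) = of_bool (\<delta> = \<gamma>) \<and> y (root_F q \<delta>) = 0))"

definition basis_f :: "real \<Rightarrow> pos_root \<Rightarrow> functional set falg set" where
  "basis_f q \<gamma> = tensor_vec (cotangent_space q) (THE v. v \<in> carrier (cotangent_space q) \<and>
     (\<forall>y\<in>v. \<forall>\<delta>. y (root_E q \<delta>) = 0 \<and> y (root_F q \<delta>) = of_bool (\<delta> = \<gamma>)))"

text \<open>The element \<open>[a\<^sup>+] \<otimes> [b\<^sup>+]\<close>, summed over the pairs \<open>(a, b)\<close> in a list.\<close>

definition class_tensor ::
  "real \<Rightarrow> (functional \<times> functional) list \<Rightarrow> functional set falg set" where
  "class_tensor q bs = foldr (\<lambda>(a, b) s.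
      (tensor_vec (cotangent_space q) (cotangent_class q (plus_part a)) \<otimes>\<^bsub>TV q\<^esub>
       tensor_vec (cotangent_space q) (cotangent_class q (plus_part b))) \<oplus>\<^bsub>TV q\<^esub> s) bs \<zero>\<^bsub>TV q\<^esub>"

definition degree_two_relators :: "real \<Rightarrow> functional set falg set set" where
  "degree_two_relators q = {class_tensor q bs | y bs. y \<in> tangent_annihilator q (Oq_F3 q) \<and>
     set bs \<subseteq> Oq_SU3 q \<times> Oq_SU3 q \<and> is_coproduct y bs}"

definition quantum_exterior_algebra :: "real \<Rightarrow> functional set falg set set ring" where
  "quantum_exterior_algebra q = TV q Quot (Idl\<^bsub>TV q\<^esub> (degree_two_relators q))"

end

theory Submission
  imports Defs "HOL-Library.Function_Algebras"
begin

text \<open>Evaluation of \<open>y \<in> I\<close> on products shows that \<open>[y\<^sub>(\<^sub>1\<^sub>)\<^sup>+] \<otimes> [y\<^sub>(\<^sub>2\<^sub>)\<^sup>+]\<close> has the coordinates \<open>y(X\<^sub>s X\<^sub>t)\<close> in the basis dual to the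
  root vectors \<open>X\<^sub>s\<close>. On \<open>B\<close> the \<open>K\<^sub>i\<close> act trivially from the right, so the commutation relations of \<open>U\<^sub>q(sl\<^sub>3)\<close>,
  read modulo \<open>T\<close>, the constants and the left ideal generated by the \<open>K\<^sub>i - 1\<close>, give fifteen linear equations between these
  coordinates; hence \<open>I\<^sup>(\<^sup>2\<^sup>)\<close> is contained in the span of the twenty-one listed relations.
  Conversely, the elements \<open>u\<^sub>i\<^sub>j S(u\<^sub>j\<^sub>j)\<close>, \<open>i \<noteq> j\<close>, of \<open>B\<close> are weight vectors and, suitably scaled, dual to the root vectors;
  their products \<open>z\<^sub>t z\<^sub>s\<close> in the right order lie in \<open>I\<close>, and a comparison of weights shows that each of them yields
  one relation, up to a multiple of the relation for \<open>e\<^sub>\<gamma> \<and> f\<^sub>\<gamma>\<close>, \<open>\<gamma> = \<alpha>\<^sub>1 + \<alpha>\<^sub>2\<close>, in weight zero.\<close>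

section \<open>Linear maps on free algebras\<close>

text \<open>Functionals live on the free algebra, and no basis of the quantised enveloping algebra
  enters. Instead every defining relation becomes an identity between operators on the dual, and
  simplification puts operator products into normal order: F outermost, then E, and K innermost,
  where it disappears on elements of B. That convolution and antipode respect the relations is
  checked in the same way.

  Equations and relations are dual to each other: the equations express fifteen of the thirty-six
  coordinates by the remaining ones, which sit at the left-hand monomials of the relations. This
  explains the place of \<nu>. The commutator of E and F at the root \<alpha>_1 + \<alpha>_2 puts
  \<nu> into a single equation, in front of the coordinates at \<alpha>_1 and \<alpha>_2;
  transposed, it appears in the relations of these two roots, with opposite signs.

  The dual functionals serve twice. They show that all six coordinates on the cotangent space are
  independent, which gives the definite descriptions of classes and basis vectors their meaning, and
  their products supply enough elements of I.\<close>

lemma scalar_add: "scalar (c + d) = scalar c + scalar d"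
  by (simp add: scalar_def single_add)

lemma scalar_diff: "scalar (c - d) = scalar c - scalar d"
  by (simp add: scalar_def single_diff)

lemma scalar_uminus: "scalar (- c) = - scalar c"
  by (simp add: scalar_def single_uminus)

lemma scalar_mult: "scalar (c * d) = scalar c * scalar d"
  by (simp add: scalar_def mult_single)

lemma scalar_0 [simp]: "scalar 0 = 0"
  by (simp add: scalar_def)

lemma scalar_1 [simp]: "scalar 1 = 1"
  by (simp add: scalar_def)

lemma scalar_single: "scalar c * Poly_Mapping.single w d = Poly_Mapping.single w (c * d)"
  by (simp add: scalar_def mult_single)

text \<open>For statements linear in \<open>p\<close> monomials suffice, since inserting a fresh key
  means adding a monomial.\<close>

lemma poly_mapping_linear_induct [case_names add single]:
  fixes p :: "'a \<Rightarrow>\<^sub>0 'b::comm_monoid_add"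
  assumes add: "\<And>p r. P p \<Longrightarrow> P r \<Longrightarrow> P (p + r)"
    and single: "\<And>w c. P (Poly_Mapping.single w c)"
  shows "P p"
proof (induction p rule: update_induct)
  case const
  show ?case using single[of undefined 0] by simp
next
  case (update p a b)
  have "Poly_Mapping.update a b p = p + Poly_Mapping.single a b"
    using update.hyps
    by (intro poly_mapping_eqI)
      (auto simp: lookup_add lookup_update lookup_single when_def in_keys_iff)
  then show ?case using add[OF update.IH single] by simp
qed

lemma scalar_commute: "p * scalar c = scalar c * p"
  by (induction p rule: poly_mapping_linear_induct)
    (simp_all add: distrib_left distrib_right scalar_def mult_single mult.commute)

lemma scalar_left_commute: "p * (scalar c * r) = scalar c * (p * r)"
  by (metis mult.assoc scalar_commute)

lemma lookup_scalar_mult: "Poly_Mapping.lookup (scalar c * p) w = c * Poly_Mapping.lookup p w"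
  by (induction p rule: poly_mapping_linear_induct)
    (simp_all add: distrib_left lookup_add scalar_single lookup_single when_def)

lemma single_eq_scalar: "Poly_Mapping.single w c = scalar c * Poly_Mapping.single w 1"
  by (simp add: scalar_single)

lemma single_Cons: "Poly_Mapping.single (Word (g # gs)) (1::complex) = letter g * Poly_Mapping.single (Word gs) 1"
  by (simp add: letter_def mult_single plus_fword_def)

lemma single_Nil: "Poly_Mapping.single (Word []) (1::complex) = 1"
  by (simp flip: zero_fword_def)

lemma falg_induct [case_names one letter add scalar]:
  fixes p :: "'a falg"
  assumes "P 1" and letter: "\<And>g p. P p \<Longrightarrow> P (letter g * p)"
    and "\<And>p r. P p \<Longrightarrow> P r \<Longrightarrow> P (p + r)" and "\<And>c p. P p \<Longrightarrow> P (scalar c * p)"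
  shows "P p"
proof (induction p rule: poly_mapping_linear_induct)
  case (single w c)
  have "P (Poly_Mapping.single (Word gs) 1)" for gs
    by (induction gs) (simp_all add: single_Nil single_Cons assms)
  then have "P (Poly_Mapping.single w 1)" by (cases w) simp
  then show ?case by (subst single_eq_scalar) (rule assms)
qed (rule assms)

text \<open>Splits off the last letter, which is the first to act: \<open>left_act (X * Y)\<close>
  applies \<open>left_act Y\<close> before \<open>left_act X\<close>.\<close>

lemma falg_induct_right [case_names one letter add scalar]:
  fixes p :: "'a falg"
  assumes "P 1" and letter: "\<And>g p. P p \<Longrightarrow> P (p * letter g)"
    and "\<And>p r. P p \<Longrightarrow> P r \<Longrightarrow> P (p + r)" and "\<And>c p. P p \<Longrightarrow> P (scalar c * p)"
  shows "P p"
proof (induction p rule: poly_mapping_linear_induct)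
  case (single w c)
  have *: "Poly_Mapping.single (Word (gs @ [g])) (1::complex) = Poly_Mapping.single (Word gs) 1 * letter g" for gs g
    by (simp add: letter_def mult_single plus_fword_def)
  have "P (Poly_Mapping.single (Word gs) 1)" for gs
    by (induction gs rule: rev_induct) (simp_all add: single_Nil * assms)
  then have "P (Poly_Mapping.single w 1)" by (cases w) simp
  then show ?case by (subst single_eq_scalar) (rule assms)
qed (rule assms)

lemma sum_keys_superset:
  assumes "finite S" "Poly_Mapping.keys p \<subseteq> S" "\<And>w. h 0 w = 0"
  shows "(\<Sum>w\<in>Poly_Mapping.keys p. h (Poly_Mapping.lookup p w) w) = (\<Sum>w\<in>S. h (Poly_Mapping.lookup p w) w)"
  using assms by (intro sum.mono_neutral_left) (auto simp: in_keys_iff)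

text \<open>Keys can cancel in \<open>p + r\<close>, so all three sums are first extended to the
  union of the supports; \<open>h 0 w = 0\<close> makes the extension harmless.\<close>

lemma sum_keys_add:
  assumes "\<And>w. h 0 w = 0" "\<And>c d w. h (c + d) w = h c w + h d w"
  shows "(\<Sum>w\<in>Poly_Mapping.keys (p + r). h (Poly_Mapping.lookup (p + r) w) w)
    = (\<Sum>w\<in>Poly_Mapping.keys p. h (Poly_Mapping.lookup p w) w) + (\<Sum>w\<in>Poly_Mapping.keys r. h (Poly_Mapping.lookup r w) w)"
proof -
  let ?S = "Poly_Mapping.keys p \<union> Poly_Mapping.keys r"
  have *: "(\<Sum>w\<in>Poly_Mapping.keys t. h (Poly_Mapping.lookup t w) w) = (\<Sum>w\<in>?S. h (Poly_Mapping.lookup t w) w)"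
    if "Poly_Mapping.keys t \<subseteq> ?S" for t
    using that assms(1) by (intro sum_keys_superset) auto
  show ?thesis
    unfolding *[OF keys_add] *[OF Un_upper1] *[OF Un_upper2] by (simp add: lookup_add assms(2) sum.distrib)
qed

lemma sum_keys_scalar:
  fixes p :: "'w::monoid_add \<Rightarrow>\<^sub>0 complex"
  assumes "\<And>w. h 0 w = 0"
  shows "(\<Sum>w\<in>Poly_Mapping.keys (scalar c * p). h (Poly_Mapping.lookup (scalar c * p) w) w)
    = (\<Sum>w\<in>Poly_Mapping.keys p. h (c * Poly_Mapping.lookup p w) w)"
  using sum_keys_superset[of "Poly_Mapping.keys p" "scalar c * p" h] assms
  by (auto simp: lookup_scalar_mult in_keys_iff subset_iff)

lemma sum_keys_single:
  assumes "h 0 w = 0"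
  shows "(\<Sum>v\<in>Poly_Mapping.keys (Poly_Mapping.single w c). h (Poly_Mapping.lookup (Poly_Mapping.single w c) v) v) = h c w"
  using assms by (cases "c = 0") simp_all

lemma lin_ext_add: "lin_ext h (p + r) = lin_ext h p + lin_ext h r"
  unfolding lin_ext_def by (rule sum_keys_add) (simp_all add: scalar_add distrib_right)

lemma lin_ext_scalar: "lin_ext h (scalar c * p) = scalar c * lin_ext h p"
  unfolding lin_ext_def
  by (subst sum_keys_scalar) (simp_all add: scalar_mult sum_distrib_left mult.assoc)

lemma lin_ext_single: "lin_ext h (Poly_Mapping.single w c) = scalar c * h w"
  unfolding lin_ext_def by (subst sum_keys_single) simp_all

lemma lin_ext_word: "lin_ext h (Poly_Mapping.single w 1) = h w"
  by (simp add: lin_ext_single)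

lemma lin_ext_mult:
  assumes one: "h (Word []) = 1" and Cons: "\<And>g gs. h (Word (g # gs)) = h (Word [g]) * h (Word gs)"
  shows "lin_ext h (p * r) = lin_ext h p * lin_ext h r"
proof (induction p rule: falg_induct)
  case one
  have "lin_ext h 1 = 1" using lin_ext_word[of h "Word []"] assms by (simp add: single_Nil)
  then show ?case by simp
next
  case (letter g p)
  have *: "lin_ext h (letter g * s) = h (Word [g]) * lin_ext h s" for s
  proof (induction s rule: poly_mapping_linear_induct)
    case (single w c)
    obtain gs where "w = Word gs" by (cases w)
    then show ?case
      by (simp add: letter_def mult_single plus_fword_def lin_ext_single Cons[of g gs] scalar_left_commute)
  qed (simp add: distrib_left lin_ext_add)
  show ?case by (simp add: * letter mult.assoc)
qed (simp_all add: distrib_right lin_ext_add lin_ext_scalar mult.assoc)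

text \<open>The variant for the antipode, which reverses words; as in the multiplicative case,
  prefixing a single letter is all that has to be tested.\<close>

lemma lin_ext_antimult:
  assumes one: "h (Word []) = 1" and Cons: "\<And>g gs. h (Word (g # gs)) = h (Word gs) * h (Word [g])"
  shows "lin_ext h (p * r) = lin_ext h r * lin_ext h p"
proof (induction p rule: falg_induct)
  case one
  have "lin_ext h 1 = 1" using lin_ext_word[of h "Word []"] assms by (simp add: single_Nil)
  then show ?case by simp
next
  case (letter g p)
  have *: "lin_ext h (letter g * s) = lin_ext h s * h (Word [g])" for s
  proof (induction s rule: poly_mapping_linear_induct)
    case (single w c)
    obtain gs where "w = Word gs" by (cases w)
    then show ?case
      by (simp add: letter_def mult_single plus_fword_def lin_ext_single Cons[of g gs] mult.assoc)
  qed (simp add: distrib_left distrib_right lin_ext_add)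
  show ?case by (simp add: * letter mult.assoc)
qed (simp_all add: distrib_right distrib_left lin_ext_add lin_ext_scalar mult.assoc scalar_left_commute)

section \<open>Coproduct, antipode and star on the free algebra\<close>

lemma coproduct_add: "coproduct (X + Y) = coproduct X + coproduct Y"
  by (simp add: coproduct_def lin_ext_add)

lemma coproduct_scalar: "coproduct (scalar c * X) = scalar c * coproduct X"
  by (simp add: coproduct_def lin_ext_scalar)

lemma coproduct_mult: "coproduct (X * Y) = coproduct X * coproduct Y"
  unfolding coproduct_def by (rule lin_ext_mult) simp_all

lemma coproduct_letter: "coproduct (letter g) = gen_coproduct g"
  by (simp add: coproduct_def letter_def lin_ext_word)

lemma coproduct_1: "coproduct 1 = 1"
  using lin_ext_word[of "\<lambda>w. prod_list (map gen_coproduct (letters w))" "Word []"]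
  by (simp add: coproduct_def single_Nil)

lemma antipode_add: "antipode (X + Y) = antipode X + antipode Y"
  by (simp add: antipode_def lin_ext_add)

lemma antipode_scalar: "antipode (scalar c * X) = scalar c * antipode X"
  by (simp add: antipode_def lin_ext_scalar)

lemma antipode_mult: "antipode (X * Y) = antipode Y * antipode X"
  unfolding antipode_def by (rule lin_ext_antimult) simp_all

lemma antipode_letter: "antipode (letter g) = gen_antipode g"
  by (simp add: antipode_def letter_def lin_ext_word)

lemma antipode_1: "antipode 1 = 1"
  using lin_ext_word[of "\<lambda>w. prod_list (map gen_antipode (rev (letters w)))" "Word []"]
  by (simp add: antipode_def single_Nil)

lemma star_add: "star (X + Y) = star X + star Y"
  unfolding star_def by (rule sum_keys_add) (simp_all add: scalar_add distrib_right)

lemma star_single: "star (Poly_Mapping.single w c) = scalar (cnj c) * prod_list (map gen_star (rev (letters w)))"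
  unfolding star_def by (subst sum_keys_single) simp_all

lemma root_F_simple:
  "root_F q Alpha1 = K\<^sub>U N1 * F\<^sub>U N1" "root_F q Alpha2 = K\<^sub>U N2 * F\<^sub>U N2"
  by (simp_all add: root_F_def letter_def star_single)

text \<open>The star reverses products, so the index order 2, 1 turns into 1, 2; the coefficient
  survives because \<open>q\<close> is real.\<close>

lemma root_F_Alpha12:
  "root_F q Alpha12 = K\<^sub>U N1 * F\<^sub>U N1 * (K\<^sub>U N2 * F\<^sub>U N2)
     - scalar (qpow q (-1)) * (K\<^sub>U N2 * F\<^sub>U N2 * (K\<^sub>U N1 * F\<^sub>U N1))"
proof -
  have "root_E q Alpha12 = Poly_Mapping.single (Word [GE N2, GE N1]) 1
      + Poly_Mapping.single (Word [GE N1, GE N2]) (- qpow q (-1))"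
    by (simp add: letter_def mult_single scalar_single plus_fword_def single_uminus)
  then show ?thesis
    by (simp add: root_F_def star_add star_single scalar_uminus mult.assoc)
qed

section \<open>Linear functionals and their actions\<close>

definition linear_functional :: "functional \<Rightarrow> bool" where
  "linear_functional a \<longleftrightarrow> (\<forall>X Y. a (X + Y) = a X + a Y) \<and> (\<forall>c X. a (scalar c * X) = c * a X)"

lemma linear_functionalD:
  assumes "linear_functional a"
  shows "a (X + Y) = a X + a Y" "a (scalar c * X) = c * a X"
    "a 0 = 0" "a (- X) = - a X" "a (X - Y) = a X - a Y"
proof -
  show add: "a (X + Y) = a X + a Y" and sc: "a (scalar c * X) = c * a X" for X Y c
    using assms by (auto simp: linear_functional_def)
  show zero: "a 0 = 0" using sc[of 0 0] by simp
  show neg: "a (- X) = - a X" for X using sc[of "-1" X] by (simp add: scalar_uminus)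
  show "a (X - Y) = a X - a Y" using add[of X "- Y"] neg[of Y] by simp
qed

lemma linear_functional_sum_keys:
  "linear_functional (\<lambda>X. \<Sum>w\<in>Poly_Mapping.keys X. Poly_Mapping.lookup X w * h w)"
  unfolding linear_functional_def
proof (intro conjI allI)
  show "(\<Sum>w\<in>Poly_Mapping.keys (X + Y). Poly_Mapping.lookup (X + Y) w * h w) =
    (\<Sum>w\<in>Poly_Mapping.keys X. Poly_Mapping.lookup X w * h w) + (\<Sum>w\<in>Poly_Mapping.keys Y. Poly_Mapping.lookup Y w * h w)" for X Y
    by (rule sum_keys_add) (simp_all add: distrib_right)
  show "(\<Sum>w\<in>Poly_Mapping.keys (scalar c * X). Poly_Mapping.lookup (scalar c * X) w * h w) =
    c * (\<Sum>w\<in>Poly_Mapping.keys X. Poly_Mapping.lookup X w * h w)" for c X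
    by (subst sum_keys_scalar) (simp_all add: sum_distrib_left mult.assoc)
qed

definition scale :: "complex \<Rightarrow> functional \<Rightarrow> functional" where
  "scale c a = (\<lambda>X. c * a X)"

text \<open>The translation on the other side. Elements of B are fixed by \<open>left_act\<close> of
  every K, so their weights can only be seen here.\<close>

definition right_act :: "ualg \<Rightarrow> functional \<Rightarrow> functional" where
  "right_act X a = (\<lambda>Y. a (X * Y))"

lemma scale_apply [simp]: "scale c a X = c * a X"
  by (simp add: scale_def)

lemma linear_functional_left_act: "linear_functional a \<Longrightarrow> linear_functional (left_act X a)"
  by (simp add: linear_functional_def left_act_def distrib_right mult.assoc)

lemma linear_functional_right_act: "linear_functional a \<Longrightarrow> linear_functional (right_act X a)"
  by (simp add: linear_functional_def right_act_def distrib_left scalar_left_commute)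

lemma linear_functional_closed:
  "linear_functional a \<Longrightarrow> linear_functional b \<Longrightarrow> linear_functional (a + b)"
  "linear_functional a \<Longrightarrow> linear_functional b \<Longrightarrow> linear_functional (a - b)"
  "linear_functional a \<Longrightarrow> linear_functional (- a)"
  "linear_functional a \<Longrightarrow> linear_functional (scale c a)"
  "linear_functional 0"
  by (auto simp: linear_functional_def algebra_simps)

lemma left_act_mult: "left_act (X * Y) a = left_act X (left_act Y a)"
  by (simp add: left_act_def mult.assoc)

lemma left_act_1 [simp]: "left_act 1 a = a"
  by (simp add: left_act_def)

lemma left_act_apply_1: "left_act X a 1 = a X"
  by (simp add: left_act_def)

lemma right_act_mult: "right_act (X * Y) a = right_act Y (right_act X a)"
  by (simp add: right_act_def mult.assoc)

lemma right_act_1 [simp]: "right_act 1 a = a"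
  by (simp add: right_act_def)

lemma left_act_vector [simp]:
  "left_act X (a + b) = left_act X a + left_act X b"
  "left_act X (a - b) = left_act X a - left_act X b"
  "left_act X (- a) = - left_act X a"
  "left_act X 0 = 0"
  "left_act X (scale c a) = scale c (left_act X a)"
  by (auto simp: left_act_def fun_eq_iff)

lemma right_act_vector [simp]:
  "right_act X (a + b) = right_act X a + right_act X b"
  "right_act X (a - b) = right_act X a - right_act X b"
  "right_act X (- a) = - right_act X a"
  "right_act X 0 = 0"
  "right_act X (scale c a) = scale c (right_act X a)"
  by (auto simp: right_act_def fun_eq_iff)

lemma left_act_linear:
  assumes "linear_functional a"
  shows "left_act (X + Y) a = left_act X a + left_act Y a"
    "left_act (X - Y) a = left_act X a - left_act Y a"
    "left_act (- X) a = - left_act X a"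
    "left_act 0 a = 0"
    "left_act (scalar c) a = scale c a"
  using assms
  by (auto simp: left_act_def fun_eq_iff algebra_simps linear_functionalD scalar_commute)

lemma right_act_linear:
  assumes "linear_functional a"
  shows "right_act (X + Y) a = right_act X a + right_act Y a"
    "right_act (X - Y) a = right_act X a - right_act Y a"
    "right_act (- X) a = - right_act X a"
    "right_act 0 a = 0"
    "right_act (scalar c) a = scale c a"
  using assms
  by (auto simp: right_act_def fun_eq_iff algebra_simps linear_functionalD)

lemma scale_vector:
  "scale c (a + b) = scale c a + scale c b"
  "scale c (a - b) = scale c a - scale c b"
  "scale c (- a) = - scale c a"
  "scale c 0 = 0"
  "scale c (scale d a) = scale (c * d) a"
  "scale 1 a = a" "scale 0 a = 0"
  by (auto simp: fun_eq_iff algebra_simps)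

section \<open>The convolution product\<close>

text \<open>The linear form \<open>a \<otimes> b\<close> on the tensor square. Detached from the
  coproduct, it allows factors of \<open>t\<close> to be moved onto \<open>a\<close> and
  \<open>b\<close>.\<close>

definition pair_eval :: "functional \<Rightarrow> functional \<Rightarrow> (gen fword \<times> gen fword \<Rightarrow>\<^sub>0 complex) \<Rightarrow> complex" where
  "pair_eval a b t = (\<Sum>(v, w)\<in>Poly_Mapping.keys t. Poly_Mapping.lookup t (v, w) *
       (a (Poly_Mapping.single v 1) * b (Poly_Mapping.single w 1)))"

lemma convolution_eq_pair_eval: "convolution a b X = pair_eval a b (coproduct X)"
  by (simp add: convolution_def pair_eval_def)

lemma pair_eval_alt: "pair_eval a b t = (\<Sum>vw\<in>Poly_Mapping.keys t. Poly_Mapping.lookup t vw *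
       (a (Poly_Mapping.single (fst vw) 1) * b (Poly_Mapping.single (snd vw) 1)))"
  by (simp add: pair_eval_def case_prod_unfold)

lemma pair_eval_add: "pair_eval a b (s + t) = pair_eval a b s + pair_eval a b t"
  unfolding pair_eval_alt by (rule sum_keys_add) (simp_all add: distrib_right)

lemma pair_eval_scalar: "pair_eval a b (scalar c * t) = c * pair_eval a b t"
  unfolding pair_eval_alt by (subst sum_keys_scalar) (simp_all add: sum_distrib_left mult.assoc)

lemma pair_eval_single:
  "pair_eval a b (Poly_Mapping.single (v, w) c) = c * (a (Poly_Mapping.single v 1) * b (Poly_Mapping.single w 1))"
  unfolding pair_eval_alt by (subst sum_keys_single) simp_all

lemma pair_eval_mult_single:
  "pair_eval a b (t * Poly_Mapping.single (v, w) 1)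
    = pair_eval (left_act (Poly_Mapping.single v 1) a) (left_act (Poly_Mapping.single w 1) b) t"
proof (induction t rule: poly_mapping_linear_induct)
  case (single x c)
  show ?case by (cases x) (simp add: mult_single pair_eval_single left_act_def plus_prod_def)
qed (simp add: distrib_right pair_eval_add)

lemma convolution_add:
  "convolution (a + a') b = convolution a b + convolution a' b"
  "convolution a (b + b') = convolution a b + convolution a b'"
  by (auto simp: fun_eq_iff convolution_def algebra_simps sum.distrib case_prod_unfold)

lemma convolution_scale:
  "convolution (scale c a) b = scale c (convolution a b)"
  "convolution a (scale c b) = scale c (convolution a b)"
  by (auto simp: fun_eq_iff convolution_def sum_distrib_left algebra_simps case_prod_unfold)

lemma convolution_0: "convolution 0 b = 0" "convolution a 0 = 0"
  by (auto simp: fun_eq_iff convolution_def)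

lemma convolution_uminus:
  "convolution (- a) b = - convolution a b"
  "convolution a (- b) = - convolution a b"
  by (auto simp: fun_eq_iff convolution_def case_prod_unfold sum_negf)

lemma convolution_diff:
  "convolution (a - a') b = convolution a b - convolution a' b"
  "convolution a (b - b') = convolution a b - convolution a b'"
  by (simp_all only: diff_conv_add_uminus convolution_add convolution_uminus)

lemmas convolution_vector = convolution_add convolution_diff convolution_uminus convolution_0 convolution_scale

lemma linear_functional_convolution: "linear_functional (convolution a b)"
  by (simp add: linear_functional_def convolution_eq_pair_eval coproduct_add coproduct_scalar
      pair_eval_add pair_eval_scalar)

lemma convolution_1:
  "convolution a b 1 = a 1 * b 1"
proof -
  have "(1 :: gen fword \<times> gen fword \<Rightarrow>\<^sub>0 complex) = Poly_Mapping.single (0, 0) 1"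
    by (simp flip: zero_prod_def)
  then show ?thesis
    using pair_eval_single[of a b 0 0 1] by (simp add: convolution_eq_pair_eval coproduct_1)
qed

text \<open>Twisted Leibniz rules: \<Delta> is multiplicative, and right multiplication by a term
  \<open>v \<otimes> w\<close> in the coproduct of a generator acts on the two factors
  separately.\<close>

lemma left_act_convolution:
  "left_act (E\<^sub>U i) (convolution a b)
     = convolution (left_act (E\<^sub>U i) a) (left_act (K\<^sub>U i) b) + convolution a (left_act (E\<^sub>U i) b)"
  "left_act (F\<^sub>U i) (convolution a b)
     = convolution (left_act (F\<^sub>U i) a) b + convolution (left_act (Kinv\<^sub>U i) a) (left_act (F\<^sub>U i) b)"
  "left_act (K\<^sub>U i) (convolution a b) = convolution (left_act (K\<^sub>U i) a) (left_act (K\<^sub>U i) b)"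
  "left_act (Kinv\<^sub>U i) (convolution a b) = convolution (left_act (Kinv\<^sub>U i) a) (left_act (Kinv\<^sub>U i) b)"
  unfolding letter_def
  by (auto simp: fun_eq_iff left_act_def[of _ "convolution a b"] convolution_eq_pair_eval coproduct_mult
      coproduct_letter[unfolded letter_def] distrib_left pair_eval_add pair_eval_mult_single)

lemma sum_list_mult_sum_list:
  fixes f :: "'a \<Rightarrow> 'c::semiring_0"
  shows "sum_list (map f xs) * sum_list (map g ys) = (\<Sum>x\<leftarrow>xs. \<Sum>y\<leftarrow>ys. f x * g y)"
  by (induction xs) (simp_all add: distrib_right sum_list_const_mult)

text \<open>The coproduct of \<open>a \<otimes> b\<close> is formed leg by leg; bilinearity in
  \<open>s\<close> and \<open>t\<close> reduces this to pairs of words.\<close>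

lemma pair_eval_mult:
  assumes "is_coproduct a as" "is_coproduct b bs"
  shows "pair_eval a b (s * t)
    = (\<Sum>(a1, a2)\<leftarrow>as. \<Sum>(b1, b2)\<leftarrow>bs. pair_eval a1 b1 s * pair_eval a2 b2 t)"
proof (induction s rule: poly_mapping_linear_induct)
  case (add p r)
  then show ?case
    by (simp add: distrib_right pair_eval_add sum_list_addf case_prod_unfold)
next
  case (single vw c)
  obtain v w where vw: "vw = (v, w)" by (cases vw)
  show ?case
  proof (induction t rule: poly_mapping_linear_induct)
    case (add p r)
    then show ?case
      by (simp add: distrib_left pair_eval_add sum_list_addf case_prod_unfold)
  next
    case (single vw' c')
    obtain v' w' where vw': "vw' = (v', w')" by (cases vw')
    have "a (Poly_Mapping.single (v + v') 1)
        = (\<Sum>(a1, a2)\<leftarrow>as. a1 (Poly_Mapping.single v 1) * a2 (Poly_Mapping.single v' 1))"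
      "b (Poly_Mapping.single (w + w') 1)
        = (\<Sum>(b1, b2)\<leftarrow>bs. b1 (Poly_Mapping.single w 1) * b2 (Poly_Mapping.single w' 1))"
      using assms mult_single[of v "1::complex" v' 1] mult_single[of w "1::complex" w' 1]
      unfolding is_coproduct_def by (metis mult_1)+
    then have "pair_eval a b (Poly_Mapping.single vw c * Poly_Mapping.single vw' c')
        = (\<Sum>x\<leftarrow>as. \<Sum>y\<leftarrow>bs. c * c' *
            (fst x (Poly_Mapping.single v 1) * snd x (Poly_Mapping.single v' 1) *
             (fst y (Poly_Mapping.single w 1) * snd y (Poly_Mapping.single w' 1))))"
      by (simp add: vw vw' mult_single plus_prod_def pair_eval_single case_prod_unfold
          sum_list_mult_sum_list sum_list_const_mult)
    then show ?case
      by (simp add: vw vw' pair_eval_single case_prod_unfold algebra_simps)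
  qed
qed

lemma is_coproduct_convolution:
  assumes "is_coproduct a as" "is_coproduct b bs"
  shows "is_coproduct (convolution a b)
    (concat (map (\<lambda>(a1, a2). map (\<lambda>(b1, b2). (convolution a1 b1, convolution a2 b2)) bs) as))"
proof -
  have "(\<Sum>(a, b)\<leftarrow>concat (map (\<lambda>(a1, a2). map (\<lambda>(b1, b2). (convolution a1 b1, convolution a2 b2)) bs) cs). a X * b Y)
    = (\<Sum>(a1, a2)\<leftarrow>cs. \<Sum>(b1, b2)\<leftarrow>bs. convolution a1 b1 X * convolution a2 b2 Y)" for X Y cs
    by (induction cs) (auto simp: case_prod_unfold o_def)
  then show ?thesis
    by (simp add: is_coproduct_def convolution_eq_pair_eval coproduct_mult pair_eval_mult[OF assms])
qed

section \<open>Functionals on the quantised enveloping algebra\<close>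

lemma ring_free_algebra: "ring (free_algebra X)"
proof (rule ringI)
  show "abelian_group (free_algebra X)"
  proof (rule abelian_groupI)
    fix p assume p: "p \<in> carrier (free_algebra X)"
    then show "\<exists>r\<in>carrier (free_algebra X). r \<oplus>\<^bsub>free_algebra X\<^esub> p = \<zero>\<^bsub>free_algebra X\<^esub>"
      by (intro bexI[of _ "- p"]) (auto simp: free_algebra_def in_keys_iff)
  qed (auto simp: free_algebra_def add_ac dest!: subsetD[OF keys_add])
  show "monoid (free_algebra X)"
  proof (rule monoidI)
    fix p r assume "p \<in> carrier (free_algebra X)" "r \<in> carrier (free_algebra X)"
    then show "p \<otimes>\<^bsub>free_algebra X\<^esub> r \<in> carrier (free_algebra X)"
      by (fastforce simp: free_algebra_def plus_fword_def dest!: subsetD[OF keys_mult])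
  qed (auto simp: free_algebra_def zero_fword_def mult.assoc)
qed (auto simp: free_algebra_def algebra_simps)

lemma free_algebra_simps:
  "\<zero>\<^bsub>free_algebra X\<^esub> = 0" "\<one>\<^bsub>free_algebra X\<^esub> = 1"
  "p \<oplus>\<^bsub>free_algebra X\<^esub> r = p + r" "p \<otimes>\<^bsub>free_algebra X\<^esub> r = p * r"
  by (simp_all add: free_algebra_def)

lemma free_algebra_UNIV_carrier: "carrier (free_algebra UNIV) = UNIV"
  by (simp add: free_algebra_def)

lemma free_algebra_a_inv:
  assumes "p \<in> carrier (free_algebra X)"
  shows "\<ominus>\<^bsub>free_algebra X\<^esub> p = - p"
proof -
  interpret ring "free_algebra X" by (rule ring_free_algebra)
  have "- p \<in> carrier (free_algebra X)" using assms by (auto simp: free_algebra_def in_keys_iff)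
  then show ?thesis
    using assms by (intro minus_equality) (simp_all add: free_algebra_simps)
qed

lemma Uq_ideal: "ideal (Uq_ideal q) (free_algebra UNIV)"
  unfolding Uq_ideal_def
  by (rule ring.genideal_ideal[OF ring_free_algebra]) (simp add: free_algebra_UNIV_carrier)

lemma Uq_ideal_mult: "r \<in> Uq_relators q \<Longrightarrow> X * r * Y \<in> Uq_ideal q"
proof -
  assume "r \<in> Uq_relators q"
  then have "r \<in> Uq_ideal q"
    unfolding Uq_ideal_def
    using ring.genideal_self[OF ring_free_algebra, of "Uq_relators q" UNIV]
    by (auto simp: free_algebra_UNIV_carrier)
  then show ?thesis
    using ideal.I_l_closed[OF Uq_ideal, of r q X] ideal.I_r_closed[OF Uq_ideal, of "X * r" q Y]
    by (simp add: free_algebra_UNIV_carrier free_algebra_simps)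
qed

lemma Uq_dual_iff:
  "a \<in> Uq_dual q \<longleftrightarrow> linear_functional a \<and> (\<forall>r\<in>Uq_relators q. \<forall>X Y. a (X * r * Y) = 0)"
proof safe
  assume "a \<in> Uq_dual q"
  then show "linear_functional a"
    by (auto simp: Uq_dual_def linear_functional_def)
next
  fix r X Y assume "a \<in> Uq_dual q" "r \<in> Uq_relators q"
  then show "a (X * r * Y) = 0"
    using Uq_ideal_mult[of r q X Y] by (auto simp: Uq_dual_def)
next
  assume lin: "linear_functional a" and rel: "\<forall>r\<in>Uq_relators q. \<forall>X Y. a (X * r * Y) = 0"
  \<comment> \<open>This is the largest two-sided ideal inside the kernel of \<open>a\<close>. Once
    it contains the relators it contains \<open>Uq_ideal q\<close>, and the elements of the latter
    need not be written out.\<close>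
  have "ideal {p. \<forall>X Y. a (X * p * Y) = 0} (free_algebra UNIV)"
  proof (rule idealI[OF ring_free_algebra])
    show "subgroup {p. \<forall>X Y. a (X * p * Y) = 0} (add_monoid (free_algebra UNIV))"
    proof (rule group.subgroupI[OF abelian_group.a_group[OF ring.is_abelian_group[OF ring_free_algebra]]])
      fix p assume "p \<in> {p. \<forall>X Y. a (X * p * Y) = 0}"
      moreover have "inv\<^bsub>add_monoid (free_algebra UNIV)\<^esub> p = - p"
        using free_algebra_a_inv[of p UNIV] by (simp add: a_inv_def free_algebra_UNIV_carrier)
      ultimately show "inv\<^bsub>add_monoid (free_algebra UNIV)\<^esub> p \<in> {p. \<forall>X Y. a (X * p * Y) = 0}"
        by (simp add: linear_functionalD[OF lin])
    qed (auto simp: free_algebra_UNIV_carrier free_algebra_simps distrib_left distrib_right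
        linear_functionalD[OF lin] intro: exI[of _ 0])
  next
    fix p x assume "p \<in> {p. \<forall>X Y. a (X * p * Y) = 0}"
    then have "a (X * p * Y) = 0" for X Y by blast
    from this[of "_ * x"] this[of _ "x * _"]
    show "x \<otimes>\<^bsub>free_algebra UNIV\<^esub> p \<in> {p. \<forall>X Y. a (X * p * Y) = 0}"
      "p \<otimes>\<^bsub>free_algebra UNIV\<^esub> x \<in> {p. \<forall>X Y. a (X * p * Y) = 0}"
      by (simp_all add: free_algebra_simps mult.assoc)
  qed
  then have "Uq_ideal q \<subseteq> {p. \<forall>X Y. a (X * p * Y) = 0}"
    unfolding Uq_ideal_def using rel by (intro ring.genideal_minimal[OF ring_free_algebra]) auto
  then have "a X = 0" if "X \<in> Uq_ideal q" for X
    using that by (metis (mono_tags, lifting) mem_Collect_eq mult_1 mult_1_right subsetD)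
  then show "a \<in> Uq_dual q"
    using lin by (simp add: Uq_dual_def linear_functional_def)
qed

lemma Uq_dual_linear: "a \<in> Uq_dual q \<Longrightarrow> linear_functional a"
  by (simp add: Uq_dual_iff)

lemma Uq_dual_closed [simp]:
  "a \<in> Uq_dual q \<Longrightarrow> b \<in> Uq_dual q \<Longrightarrow> a + b \<in> Uq_dual q"
  "a \<in> Uq_dual q \<Longrightarrow> scale c a \<in> Uq_dual q"
  "a \<in> Uq_dual q \<Longrightarrow> left_act X a \<in> Uq_dual q"
  "a \<in> Uq_dual q \<Longrightarrow> right_act X a \<in> Uq_dual q"
  by (simp_all add: Uq_dual_iff linear_functional_closed linear_functional_left_act linear_functional_right_act)
    (simp_all add: left_act_def right_act_def mult.assoc, metis mult.assoc)

text \<open>A relator acts as zero by either translation; this turns the defining relations into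
  operator identities on the dual.\<close>

lemma left_act_relator: "a \<in> Uq_dual q \<Longrightarrow> r \<in> Uq_relators q \<Longrightarrow> left_act r a = 0"
  by (auto simp: Uq_dual_iff left_act_def fun_eq_iff) (metis mult_1_right)

lemma right_act_relator: "a \<in> Uq_dual q \<Longrightarrow> r \<in> Uq_relators q \<Longrightarrow> right_act r a = 0"
  by (auto simp: Uq_dual_iff right_act_def fun_eq_iff) (metis mult_1)

lemma Uq_relators_intros:
  "K\<^sub>U i * Kinv\<^sub>U i - 1 \<in> Uq_relators q"
  "Kinv\<^sub>U i * K\<^sub>U i - 1 \<in> Uq_relators q"
  "K\<^sub>U i * K\<^sub>U j - K\<^sub>U j * K\<^sub>U i \<in> Uq_relators q"
  "K\<^sub>U i * E\<^sub>U j - scalar (qpow q (cartan i j)) * (E\<^sub>U j * K\<^sub>U i) \<in> Uq_relators q"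
  "K\<^sub>U i * F\<^sub>U j - scalar (qpow q (- cartan i j)) * (F\<^sub>U j * K\<^sub>U i) \<in> Uq_relators q"
  "E\<^sub>U i * F\<^sub>U j - F\<^sub>U j * E\<^sub>U i
    - (if i = j then scalar (inverse (nu q)) * (K\<^sub>U i - Kinv\<^sub>U i) else 0) \<in> Uq_relators q"
  "i \<noteq> j \<Longrightarrow> E\<^sub>U i * E\<^sub>U i * E\<^sub>U j - scalar (complex_of_real (q + inverse q)) * (E\<^sub>U i * E\<^sub>U j * E\<^sub>U i)
    + E\<^sub>U j * E\<^sub>U i * E\<^sub>U i \<in> Uq_relators q"
  "i \<noteq> j \<Longrightarrow> F\<^sub>U i * F\<^sub>U i * F\<^sub>U j - scalar (complex_of_real (q + inverse q)) * (F\<^sub>U i * F\<^sub>U j * F\<^sub>U i)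
    + F\<^sub>U j * F\<^sub>U i * F\<^sub>U i \<in> Uq_relators q"
  unfolding Uq_relators_def by blast+

lemma Uq_relatorsE:
  assumes "r \<in> Uq_relators q"
  obtains i where "r = K\<^sub>U i * Kinv\<^sub>U i - 1"
  | i where "r = Kinv\<^sub>U i * K\<^sub>U i - 1"
  | i j where "r = K\<^sub>U i * K\<^sub>U j - K\<^sub>U j * K\<^sub>U i"
  | i j where "r = K\<^sub>U i * E\<^sub>U j - scalar (qpow q (cartan i j)) * (E\<^sub>U j * K\<^sub>U i)"
  | i j where "r = K\<^sub>U i * F\<^sub>U j - scalar (qpow q (- cartan i j)) * (F\<^sub>U j * K\<^sub>U i)"
  | i where "r = E\<^sub>U i * F\<^sub>U i - F\<^sub>U i * E\<^sub>U i - scalar (inverse (nu q)) * (K\<^sub>U i - Kinv\<^sub>U i)"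
  | i j where "i \<noteq> j" "r = E\<^sub>U i * F\<^sub>U j - F\<^sub>U j * E\<^sub>U i"
  | i j where "i \<noteq> j" "r = E\<^sub>U i * E\<^sub>U i * E\<^sub>U j
      - scalar (complex_of_real (q + inverse q)) * (E\<^sub>U i * E\<^sub>U j * E\<^sub>U i) + E\<^sub>U j * E\<^sub>U i * E\<^sub>U i"
  | i j where "i \<noteq> j" "r = F\<^sub>U i * F\<^sub>U i * F\<^sub>U j
      - scalar (complex_of_real (q + inverse q)) * (F\<^sub>U i * F\<^sub>U j * F\<^sub>U i) + F\<^sub>U j * F\<^sub>U i * F\<^sub>U i"
  using assms unfolding Uq_relators_def
  by (elim UnE CollectE exE conjE) (auto split: if_splits)

section \<open>The defining relations as operator identities\<close>

context
  fixes q :: real and a :: functional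
  assumes a: "a \<in> Uq_dual q"
begin

lemmas linear_a = Uq_dual_linear[OF a] linear_functional_left_act

lemma left_K_Kinv:
  "left_act (K\<^sub>U i) (left_act (Kinv\<^sub>U i) a) = a"
  "left_act (Kinv\<^sub>U i) (left_act (K\<^sub>U i) a) = a"
  using left_act_relator[OF a Uq_relators_intros(1)] left_act_relator[OF a Uq_relators_intros(2)]
  by (simp_all add: left_act_linear linear_a left_act_mult)

lemma right_K_Kinv:
  "right_act (K\<^sub>U i) (right_act (Kinv\<^sub>U i) a) = a"
  "right_act (Kinv\<^sub>U i) (right_act (K\<^sub>U i) a) = a"
  using right_act_relator[OF a Uq_relators_intros(2)] right_act_relator[OF a Uq_relators_intros(1)]
  by (simp_all add: right_act_linear linear_a right_act_mult)

lemma left_K_K: "left_act (K\<^sub>U i) (left_act (K\<^sub>U j) a) = left_act (K\<^sub>U j) (left_act (K\<^sub>U i) a)"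
  using left_act_relator[OF a Uq_relators_intros(3)]
  by (simp add: left_act_linear linear_a left_act_mult)

lemma right_K_K: "right_act (K\<^sub>U i) (right_act (K\<^sub>U j) a) = right_act (K\<^sub>U j) (right_act (K\<^sub>U i) a)"
  using right_act_relator[OF a Uq_relators_intros(3)[of j i]]
  by (simp add: right_act_linear linear_a right_act_mult)

lemma left_K_EF:
  "left_act (K\<^sub>U i) (left_act (E\<^sub>U j) a) = scale (qpow q (cartan i j)) (left_act (E\<^sub>U j) (left_act (K\<^sub>U i) a))"
  "left_act (K\<^sub>U i) (left_act (F\<^sub>U j) a) = scale (qpow q (- cartan i j)) (left_act (F\<^sub>U j) (left_act (K\<^sub>U i) a))"
  using left_act_relator[OF a Uq_relators_intros(4)[of i j]] left_act_relator[OF a Uq_relators_intros(5)[of i j]]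
  by (simp_all add: left_act_linear linear_a left_act_mult del: cartan.simps)

text \<open>Right translations compose in the opposite order, so the relator with K in front yields
  the left-hand side with K inside.\<close>

lemma right_EF_K:
  "right_act (E\<^sub>U j) (right_act (K\<^sub>U i) a) = scale (qpow q (cartan i j)) (right_act (K\<^sub>U i) (right_act (E\<^sub>U j) a))"
  "right_act (F\<^sub>U j) (right_act (K\<^sub>U i) a) = scale (qpow q (- cartan i j)) (right_act (K\<^sub>U i) (right_act (F\<^sub>U j) a))"
  using right_act_relator[OF a Uq_relators_intros(4)[of i j]] right_act_relator[OF a Uq_relators_intros(5)[of i j]]
  by (simp_all add: right_act_linear linear_a right_act_mult del: cartan.simps)

lemma left_E_F:
  "left_act (E\<^sub>U i) (left_act (F\<^sub>U j) a) = left_act (F\<^sub>U j) (left_act (E\<^sub>U i) a)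
     + (if i = j then scale (inverse (nu q)) (left_act (K\<^sub>U i) a - left_act (Kinv\<^sub>U i) a) else 0)"
  using left_act_relator[OF a Uq_relators_intros(6)[of i j]]
  by (cases "i = j") (simp_all add: left_act_linear linear_a left_act_mult scale_vector algebra_simps)

lemma right_F_E:
  "right_act (F\<^sub>U j) (right_act (E\<^sub>U i) a) = right_act (E\<^sub>U i) (right_act (F\<^sub>U j) a)
     + (if i = j then scale (inverse (nu q)) (right_act (K\<^sub>U i) a - right_act (Kinv\<^sub>U i) a) else 0)"
  using right_act_relator[OF a Uq_relators_intros(6)[of i j]]
  by (cases "i = j") (simp_all add: right_act_linear linear_a right_act_mult scale_vector algebra_simps)

lemma left_serre:
  assumes "i \<noteq> j"
  shows "left_act (E\<^sub>U i) (left_act (E\<^sub>U i) (left_act (E\<^sub>U j) a))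
    = scale (complex_of_real (q + inverse q)) (left_act (E\<^sub>U i) (left_act (E\<^sub>U j) (left_act (E\<^sub>U i) a)))
      - left_act (E\<^sub>U j) (left_act (E\<^sub>U i) (left_act (E\<^sub>U i) a))"
  "left_act (F\<^sub>U i) (left_act (F\<^sub>U i) (left_act (F\<^sub>U j) a))
    = scale (complex_of_real (q + inverse q)) (left_act (F\<^sub>U i) (left_act (F\<^sub>U j) (left_act (F\<^sub>U i) a)))
      - left_act (F\<^sub>U j) (left_act (F\<^sub>U i) (left_act (F\<^sub>U i) a))"
  using left_act_relator[OF a Uq_relators_intros(7)[OF assms]] left_act_relator[OF a Uq_relators_intros(8)[OF assms]]
  by (simp_all add: left_act_linear linear_a left_act_mult scale_vector algebra_simps)

lemma right_serre:
  assumes "i \<noteq> j"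
  shows "right_act (E\<^sub>U i) (right_act (E\<^sub>U i) (right_act (E\<^sub>U j) a))
    = scale (complex_of_real (q + inverse q)) (right_act (E\<^sub>U i) (right_act (E\<^sub>U j) (right_act (E\<^sub>U i) a)))
      - right_act (E\<^sub>U j) (right_act (E\<^sub>U i) (right_act (E\<^sub>U i) a))"
  "right_act (F\<^sub>U i) (right_act (F\<^sub>U i) (right_act (F\<^sub>U j) a))
    = scale (complex_of_real (q + inverse q)) (right_act (F\<^sub>U i) (right_act (F\<^sub>U j) (right_act (F\<^sub>U i) a)))
      - right_act (F\<^sub>U j) (right_act (F\<^sub>U i) (right_act (F\<^sub>U i) a))"
  using right_act_relator[OF a Uq_relators_intros(7)[OF assms]] right_act_relator[OF a Uq_relators_intros(8)[OF assms]]
  by (simp_all add: right_act_linear linear_a right_act_mult scale_vector algebra_simps)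

end

locale quantum_parameter =
  fixes q :: real
  assumes generic: "q \<notin> {-1, 0, 1}"
begin

lemma q_nonzero [simp]: "q \<noteq> 0"
  using generic by simp

text \<open>No relator moves \<open>Kinv\<^sub>U i\<close> past E or F: the rule for K is applied to
  \<open>left_act (Kinv\<^sub>U i) a\<close>, and K is cancelled.\<close>

lemma left_Kinv_EF:
  assumes a: "a \<in> Uq_dual q"
  shows
  "left_act (Kinv\<^sub>U i) (left_act (E\<^sub>U j) a) = scale (qpow q (- cartan i j)) (left_act (E\<^sub>U j) (left_act (Kinv\<^sub>U i) a))"
  "left_act (Kinv\<^sub>U i) (left_act (F\<^sub>U j) a) = scale (qpow q (cartan i j)) (left_act (F\<^sub>U j) (left_act (Kinv\<^sub>U i) a))"
proof -
  have q: "qpow q (- n) * qpow q n = 1" for n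
    using assms by (simp add: power_int_minus field_simps)
  let ?a = "left_act (Kinv\<^sub>U i) a"
  have a': "?a \<in> Uq_dual q" using a by simp
  have "left_act (Kinv\<^sub>U i) (scale (qpow q (- cartan i j)) (left_act (K\<^sub>U i) (left_act (E\<^sub>U j) ?a)))
      = left_act (Kinv\<^sub>U i) (left_act (E\<^sub>U j) a)"
    "left_act (Kinv\<^sub>U i) (scale (qpow q (cartan i j)) (left_act (K\<^sub>U i) (left_act (F\<^sub>U j) ?a)))
      = left_act (Kinv\<^sub>U i) (left_act (F\<^sub>U j) a)"
    using q[of "cartan i j"] q[of "- cartan i j"]
    by (simp_all only: left_K_EF[OF a'] scale_vector left_K_Kinv[OF a] minus_minus)
  then show "left_act (Kinv\<^sub>U i) (left_act (E\<^sub>U j) a) = scale (qpow q (- cartan i j)) (left_act (E\<^sub>U j) ?a)"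
    "left_act (Kinv\<^sub>U i) (left_act (F\<^sub>U j) a) = scale (qpow q (cartan i j)) (left_act (F\<^sub>U j) ?a)"
    using a' by (simp_all add: left_K_Kinv[where q = q] del: cartan.simps)
qed

lemma left_Kinv_K:
  assumes a: "a \<in> Uq_dual q"
  shows "left_act (Kinv\<^sub>U i) (left_act (K\<^sub>U j) a) = left_act (K\<^sub>U j) (left_act (Kinv\<^sub>U i) a)"
  using left_K_Kinv[OF a] left_K_Kinv[OF Uq_dual_closed(3)[OF Uq_dual_closed(3)[OF a]]] left_K_K[OF Uq_dual_closed(3)[OF a]]
  by metis

lemma left_Kinv_Kinv:
  assumes a: "a \<in> Uq_dual q"
  shows "left_act (Kinv\<^sub>U i) (left_act (Kinv\<^sub>U j) a) = left_act (Kinv\<^sub>U j) (left_act (Kinv\<^sub>U i) a)"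
  by (metis a left_K_Kinv left_Kinv_K Uq_dual_closed(3))

text \<open>Rewriting to normal order: F moves outwards past E, both move outwards past K and its
  inverse. Among the latter, index 1 goes outside index 2, which orients their commutation and
  prevents loops.\<close>

lemmas left_rewrite =
  left_K_Kinv[where q = q] left_K_K[where q = q and i = N2 and j = N1]
  left_Kinv_K[symmetric, where i = N1 and j = N2] left_Kinv_K[of _ N2 N1] left_Kinv_Kinv[of _ N2 N1]
  left_K_EF[where q = q] left_Kinv_EF left_E_F[where q = q]
  left_serre[where q = q and i = N1 and j = N2] left_serre[where q = q and i = N2 and j = N1] scale_vector

lemma right_K_EF:
  assumes a: "a \<in> Uq_dual q"
  shows
  "right_act (K\<^sub>U i) (right_act (E\<^sub>U j) a) = scale (qpow q (- cartan i j)) (right_act (E\<^sub>U j) (right_act (K\<^sub>U i) a))"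
  "right_act (K\<^sub>U i) (right_act (F\<^sub>U j) a) = scale (qpow q (cartan i j)) (right_act (F\<^sub>U j) (right_act (K\<^sub>U i) a))"
  using assms by (simp_all only: right_EF_K scale_vector) (simp_all add: power_int_minus scale_vector)

lemma right_Kinv_EF:
  assumes a: "a \<in> Uq_dual q"
  shows
  "right_act (Kinv\<^sub>U i) (right_act (E\<^sub>U j) a) = scale (qpow q (cartan i j)) (right_act (E\<^sub>U j) (right_act (Kinv\<^sub>U i) a))"
  "right_act (Kinv\<^sub>U i) (right_act (F\<^sub>U j) a) = scale (qpow q (- cartan i j)) (right_act (F\<^sub>U j) (right_act (Kinv\<^sub>U i) a))"
proof -
  let ?a = "right_act (Kinv\<^sub>U i) a"
  have a': "?a \<in> Uq_dual q" using a by simp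
  have "right_act (E\<^sub>U j) a = scale (qpow q (cartan i j)) (right_act (K\<^sub>U i) (right_act (E\<^sub>U j) ?a))"
    "right_act (F\<^sub>U j) a = scale (qpow q (- cartan i j)) (right_act (K\<^sub>U i) (right_act (F\<^sub>U j) ?a))"
    using right_EF_K[OF a', of j i] by (simp_all only: right_K_Kinv[OF a])
  then show "right_act (Kinv\<^sub>U i) (right_act (E\<^sub>U j) a) = scale (qpow q (cartan i j)) (right_act (E\<^sub>U j) ?a)"
    "right_act (Kinv\<^sub>U i) (right_act (F\<^sub>U j) a) = scale (qpow q (- cartan i j)) (right_act (F\<^sub>U j) ?a)"
    using a' by (simp_all add: right_K_Kinv[where q = q] del: cartan.simps)
qed

lemma right_Kinv_K:
  assumes a: "a \<in> Uq_dual q"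
  shows "right_act (Kinv\<^sub>U i) (right_act (K\<^sub>U j) a) = right_act (K\<^sub>U j) (right_act (Kinv\<^sub>U i) a)"
  using right_K_Kinv[OF a] right_K_Kinv[OF Uq_dual_closed(4)[OF Uq_dual_closed(4)[OF a]]] right_K_K[OF Uq_dual_closed(4)[OF a]]
  by metis

lemma right_Kinv_Kinv:
  assumes a: "a \<in> Uq_dual q"
  shows "right_act (Kinv\<^sub>U i) (right_act (Kinv\<^sub>U j) a) = right_act (Kinv\<^sub>U j) (right_act (Kinv\<^sub>U i) a)"
  by (metis a right_K_Kinv right_Kinv_K Uq_dual_closed(4))

lemmas right_rewrite =
  right_K_Kinv[where q = q] right_K_K[where q = q and i = N2 and j = N1]
  right_Kinv_K[symmetric, where i = N1 and j = N2] right_Kinv_K[of _ N2 N1] right_Kinv_Kinv[of _ N2 N1]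
  right_K_EF right_Kinv_EF right_F_E[where q = q]
  right_serre[where q = q and i = N1 and j = N2] right_serre[where q = q and i = N2 and j = N1] scale_vector

text \<open>The dual form of the statement that \<Delta> respects the relations: the Leibniz rules
  distribute \<open>r\<close> over the two factors, where normal ordering cancels
  everything.\<close>

lemma left_act_relator_convolution:
  assumes "a \<in> Uq_dual q" "b \<in> Uq_dual q" and r: "r \<in> Uq_relators q"
  shows "left_act r (convolution a b) = 0"
proof -
  define Q where "Q = complex_of_real q"
  have Q: "Q \<noteq> 0" by (simp add: Q_def)
  \<comment> \<open>With the inverse of q as a second symbol and \<open>PQ\<close> as cancellation
    rules, the long sums of the Serre cases need only ring arithmetic.\<close>
  define P where "P = inverse Q"
  have PQ: "Q * P = 1" "Q * (P * x) = x" "P * (Q * x) = x" for x using Q by (simp_all add: P_def)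
  have P: "inverse (Q\<^sup>2) = P * P" "inverse Q = P" by (simp_all add: P_def power2_eq_square)
  note simps = assms(1,2) Q left_act_linear linear_functional_left_act linear_functional_convolution left_act_mult
    left_act_convolution convolution_vector left_rewrite power_int_minus Q_def[symmetric]
  from r show ?thesis
  proof (cases rule: Uq_relatorsE)
    case (3 i j) show ?thesis unfolding 3 by (cases i; cases j) (simp_all add: simps)
  next
    case (4 i j) show ?thesis unfolding 4 by (cases i; cases j) (auto simp: simps fun_eq_iff field_simps power2_eq_square)
  next
    case (5 i j) show ?thesis unfolding 5 by (cases i; cases j) (auto simp: simps fun_eq_iff field_simps power2_eq_square)
  next
    case (6 i) show ?thesis unfolding 6 by (auto simp: simps fun_eq_iff field_simps power2_eq_square)
  next
    case (7 i j) show ?thesis using 7(1) unfolding 7(2) by (cases i; cases j) (auto simp: simps fun_eq_iff field_simps power2_eq_square)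
  next
    case (8 i j) show ?thesis using 8(1) unfolding 8(2)
      by (cases i; cases j) (simp_all add: simps P, simp_all add: fun_eq_iff algebra_simps power2_eq_square PQ)
  next
    case (9 i j) show ?thesis using 9(1) unfolding 9(2)
      by (cases i; cases j) (simp_all add: simps P, simp_all add: fun_eq_iff algebra_simps power2_eq_square PQ)
  qed (simp_all add: simps)
qed

end

section \<open>The quantum coordinate algebra\<close>

lemma counit_add: "counit (X + Y) = counit X + counit Y"
  and counit_scalar: "counit (scalar c * X) = c * counit X"
  using linear_functional_sum_keys[of "\<lambda>w. prod_list (map gen_counit (letters w))"]
  by (simp_all add: linear_functional_def counit_def)

lemma linear_functional_counit: "linear_functional counit"
  by (simp add: linear_functional_def counit_add counit_scalar)

lemma counit_single: "counit (Poly_Mapping.single w c) = c * prod_list (map gen_counit (letters w))"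
  unfolding counit_def by (subst sum_keys_single) simp_all

lemma counit_1 [simp]: "counit 1 = 1"
  using counit_single[of "Word []" 1] by (simp add: single_Nil)

lemma counit_letter [simp]: "counit (letter g) = gen_counit g"
  by (simp add: letter_def counit_single)

lemma counit_mult: "counit (X * Y) = counit X * counit Y"
proof (induction X rule: falg_induct)
  case (letter g p)
  have *: "counit (letter g * s) = gen_counit g * counit s" for s
  proof (induction s rule: poly_mapping_linear_induct)
    case (single w c)
    show ?case by (simp add: letter_def mult_single plus_fword_def counit_single)
  qed (simp add: distrib_left counit_add)
  show ?case by (simp add: * letter mult.assoc)
qed (simp_all add: distrib_right counit_add counit_scalar mult.assoc)

section \<open>Matrix coefficients of the three-dimensional representation\<close>

lemma linear_functional_u_coeff: "linear_functional (u_coeff q i j)"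
  unfolding u_coeff_def by (rule linear_functional_sum_keys)

lemma u_coeff_single: "u_coeff q i j (Poly_Mapping.single w c) = c * word_u q (letters w) i j"
  unfolding u_coeff_def by (subst sum_keys_single) simp_all

lemma u_coeff_1: "u_coeff q i j 1 = of_bool (i = j)"
  using u_coeff_single[of q i j "Word []" 1] by (simp add: single_Nil)

lemma u_coeff_letter: "j \<in> {1..3} \<Longrightarrow> u_coeff q i j (letter g) = gen_u q g i j"
  by (simp add: letter_def u_coeff_single of_bool_def if_distrib sum.delta cong: if_cong)

lemma u_coeff_letter_mult: "u_coeff q i j (letter g * X) = (\<Sum>a\<in>{1..3}. gen_u q g i a * u_coeff q a j X)"
proof (induction X rule: poly_mapping_linear_induct)
  case (single w c)
  show ?case by (simp add: letter_def mult_single plus_fword_def u_coeff_single sum_distrib_left mult.left_commute)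
qed (simp add: distrib_left sum.distrib linear_functionalD linear_functional_u_coeff)

text \<open>The product rule for matrix entries. The row \<open>i\<close> has to lie in the range of
  summation: for \<open>X = 1\<close> the sum must contain the term \<open>a = i\<close>.\<close>

lemma u_coeff_mult:
  assumes "i \<in> {1..3}"
  shows "u_coeff q i j (X * Y) = (\<Sum>a\<in>{1..3}. u_coeff q i a X * u_coeff q a j Y)"
  using assms
proof (induction X arbitrary: i rule: falg_induct)
  case one
  then show ?case by (simp add: u_coeff_1 of_bool_def if_distrib[of "\<lambda>x. x * _"] sum.delta' cong: if_cong)
next
  case (letter g p)
  have "u_coeff q i j (letter g * p * Y) = (\<Sum>a\<in>{1..3}. \<Sum>b\<in>{1..3}. gen_u q g i a * (u_coeff q a b p * u_coeff q b j Y))"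
    by (simp add: mult.assoc u_coeff_letter_mult letter.IH sum_distrib_left)
  also have "\<dots> = (\<Sum>b\<in>{1..3}. \<Sum>a\<in>{1..3}. gen_u q g i a * (u_coeff q a b p * u_coeff q b j Y))"
    by (rule sum.swap)
  finally show ?case by (simp add: u_coeff_letter_mult sum_distrib_right mult.assoc)
next
  case (add p r)
  then show ?case
    by (simp add: distrib_right sum.distrib linear_functionalD linear_functional_u_coeff)
next
  case (scalar c p)
  then show ?case
    by (simp add: linear_functionalD linear_functional_u_coeff mult.assoc sum_distrib_left)
qed

lemma atLeastAtMost_1_3: "{1..3::nat} = {1, 2, 3}" "{Suc 0..3} = {1, 2, 3}"
  by auto

lemma is_coproduct_u_coeff:
  "i \<in> {1..3} \<Longrightarrow> is_coproduct (u_coeff q i j) (map (\<lambda>a. (u_coeff q i a, u_coeff q a j)) [1, 2, 3])"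
  by (simp add: is_coproduct_def u_coeff_mult atLeastAtMost_1_3)

text \<open>The antipode reverses products, hence the two legs change places.\<close>

lemma is_coproduct_antipode:
  assumes "is_coproduct a bs"
  shows "is_coproduct (a \<circ> antipode) (map (\<lambda>(b, c). (c \<circ> antipode, b \<circ> antipode)) bs)"
  using assms by (simp add: is_coproduct_def antipode_mult case_prod_unfold o_def mult.commute)

context quantum_parameter
begin

lemma q_square [simp]: "complex_of_real q * complex_of_real q \<noteq> 1"
proof -
  have "q * q \<noteq> 1" using generic by (auto simp: square_eq_1_iff)
  then show ?thesis by (metis of_real_1 of_real_eq_iff of_real_mult)
qed

lemma counit_in_Uq_dual: "counit \<in> Uq_dual q"
proof -
  have "counit r = 0" if "r \<in> Uq_relators q" for r
    using that
    by (cases rule: Uq_relatorsE)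
      (simp_all add: linear_functionalD[OF linear_functional_counit] counit_mult)
  then show ?thesis
    by (simp add: Uq_dual_iff linear_functional_counit counit_mult)
qed

text \<open>Each relator is zero as a 3 by 3 matrix, so the representation descends to the quotient;
  multiplicativity then covers \<open>X * r * Y\<close>.\<close>

lemma u_coeff_in_Uq_dual:
  assumes i: "i \<in> {1..3}"
  shows "u_coeff q i j \<in> Uq_dual q"
proof -
  define Q where "Q = complex_of_real q"
  have Q: "Q \<noteq> 0" "Q * Q \<noteq> 1" by (simp_all add: Q_def)
  note simps = linear_functionalD[OF linear_functional_u_coeff] u_coeff_mult u_coeff_letter u_coeff_1
    atLeastAtMost_1_3 power_int_minus Q_def[symmetric] Q
  have "u_coeff q a b r = 0" if r: "r \<in> Uq_relators q" and a: "a \<in> {1..3}" "b \<in> {1..3}" for r a b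
  proof -
    have a: "a \<in> {1, 2, 3}" "b \<in> {1, 2, 3}" using a by auto
    from r show ?thesis
    proof (cases rule: Uq_relatorsE)
      case (1 i) show ?thesis unfolding 1 using a by (cases i) (auto simp: simps)
    next
      case (2 i) show ?thesis unfolding 2 using a by (cases i) (auto simp: simps)
    next
      case (3 i j) show ?thesis unfolding 3 using a by (cases i; cases j) (auto simp: simps)
    next
      case (4 i j) show ?thesis unfolding 4 using a by (cases i; cases j) (auto simp: simps field_simps power2_eq_square)
    next
      case (5 i j) show ?thesis unfolding 5 using a by (cases i; cases j) (auto simp: simps field_simps power2_eq_square)
    next
      case (6 i) show ?thesis unfolding 6 using a by (cases i) (auto simp: simps field_simps)
    next
      case (7 i j) show ?thesis unfolding 7(2) using a 7(1) by (cases i; cases j) (auto simp: simps)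
    next
      case (8 i j) show ?thesis unfolding 8(2) using a 8(1) by (cases i; cases j) (auto simp: simps)
    next
      case (9 i j) show ?thesis unfolding 9(2) using a 9(1) by (cases i; cases j) (auto simp: simps)
    qed
  qed
  then have "u_coeff q a j (r * Y) = 0" if "r \<in> Uq_relators q" "a \<in> {1..3}" for r a Y
    using that by (simp add: u_coeff_mult)
  then show ?thesis
    using i by (simp add: Uq_dual_iff linear_functional_u_coeff mult.assoc u_coeff_mult)
qed

text \<open>As letters are peeled off \<open>Y\<close> from the right, the Leibniz rules replace
  \<open>a\<close> and \<open>b\<close> by translates that stay in the dual, hence
  \<open>arbitrary: a b\<close>. In the end only the relator is left to act.\<close>

lemma convolution_in_Uq_dual:
  assumes "a \<in> Uq_dual q" "b \<in> Uq_dual q"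
  shows "convolution a b \<in> Uq_dual q"
proof -
  have "left_act r (left_act Y (convolution a b)) = 0" if r: "r \<in> Uq_relators q" for r Y
    using assms
  proof (induction Y arbitrary: a b rule: falg_induct_right)
    case one
    then show ?case using r by (simp add: left_act_relator_convolution)
  next
    case (letter g p)
    then show ?case
      by (cases g)
        (simp_all add: left_act_mult left_act_convolution del: plus_fun_apply zero_fun_apply)
  qed (simp_all add: left_act_linear left_act_mult linear_functional_convolution linear_functional_left_act
      scale_vector del: plus_fun_apply zero_fun_apply)
  then have "left_act r (left_act Y (convolution a b)) X = 0" if "r \<in> Uq_relators q" for r X Y
    using that by simp
  then show ?thesis
    by (simp add: Uq_dual_iff linear_functional_convolution left_act_def mult.assoc)
qed

text \<open>The dual form of the statement that the antipode respects the relations. Reversed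
  products are tested by right translations, for which \<open>right_rewrite\<close> is set
  up.\<close>

lemma right_act_antipode_relator:
  assumes "a \<in> Uq_dual q" and r: "r \<in> Uq_relators q"
  shows "right_act (antipode r) a = 0"
proof -
  define Q where "Q = complex_of_real q"
  have Q: "Q \<noteq> 0" "Q * Q \<noteq> 1" by (simp_all add: Q_def)
  have antipode_diff: "antipode (X - Y) = antipode X - antipode Y" for X Y
    using antipode_add[of "X - Y" Y] by simp
  have antipode_0: "antipode 0 = 0"
    using antipode_add[of 0 0] by simp
  have antipode_scalar: "antipode (scalar c) = scalar c" for c
    using antipode_scalar[of c 1] by (simp add: antipode_1)
  note simps = assms(1) Q right_act_linear linear_functional_right_act Uq_dual_linear[OF assms(1)] right_act_mult
    right_rewrite power_int_minus antipode_diff antipode_add antipode_scalar antipode_mult antipode_letter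
    antipode_0 antipode_1 Q_def[symmetric] linear_functional_closed
  from r show ?thesis
  proof (cases rule: Uq_relatorsE)
    case (3 i j) show ?thesis unfolding 3 by (cases i; cases j) (simp_all add: simps)
  next
    case (4 i j) show ?thesis unfolding 4 by (cases i; cases j) (auto simp: simps fun_eq_iff field_simps power2_eq_square)
  next
    case (5 i j) show ?thesis unfolding 5 by (cases i; cases j) (auto simp: simps fun_eq_iff field_simps power2_eq_square)
  next
    case (6 i) show ?thesis unfolding 6 by (auto simp: simps fun_eq_iff field_simps power2_eq_square)
  next
    case (7 i j) show ?thesis using 7(1) unfolding 7(2) by (cases i; cases j) (auto simp: simps fun_eq_iff field_simps power2_eq_square)
  next
    case (8 i j) show ?thesis using 8(1) unfolding 8(2) by (cases i; cases j) (auto simp: simps fun_eq_iff field_simps power2_eq_square)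
  next
    case (9 i j) show ?thesis using 9(1) unfolding 9(2) by (cases i; cases j) (auto simp: simps fun_eq_iff field_simps power2_eq_square)
  qed (simp_all add: simps)
qed

lemma antipode_in_Uq_dual:
  assumes "a \<in> Uq_dual q"
  shows "a \<circ> antipode \<in> Uq_dual q"
proof -
  have "a (antipode (X * r * Y)) = 0" if "r \<in> Uq_relators q" for r X Y
  proof -
    have "a (antipode (X * r * Y)) = right_act (antipode r) (right_act (antipode Y) a) (antipode X)"
      by (simp add: antipode_mult right_act_def mult.assoc)
    then show ?thesis using right_act_antipode_relator[OF Uq_dual_closed(4)[OF assms] that] by simp
  qed
  moreover have "linear_functional (a \<circ> antipode)"
    using Uq_dual_linear[OF assms]
    by (simp add: linear_functional_def antipode_add antipode_scalar)
  ultimately show ?thesis by (simp add: Uq_dual_iff)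
qed

end

text \<open>The algebra \<open>A\<close> is defined as an intersection over all Hopf subalgebras containing the \<open>u\<^sub>i\<^sub>j\<close>, which
  carries no information unless there is one. The set below is one, so that it equals \<open>A\<close>.\<close>

inductive_set coord_algebra :: "real \<Rightarrow> functional set" for q where
  u_coeff: "i \<in> {1..3} \<Longrightarrow> j \<in> {1..3} \<Longrightarrow> u_coeff q i j \<in> coord_algebra q"
| counit: "counit \<in> coord_algebra q"
| add: "a \<in> coord_algebra q \<Longrightarrow> b \<in> coord_algebra q \<Longrightarrow> (\<lambda>X. a X + b X) \<in> coord_algebra q"
| scale: "a \<in> coord_algebra q \<Longrightarrow> (\<lambda>X. c * a X) \<in> coord_algebra q"
| convolution: "a \<in> coord_algebra q \<Longrightarrow> b \<in> coord_algebra q \<Longrightarrow> convolution a b \<in> coord_algebra q"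
| antipode: "a \<in> coord_algebra q \<Longrightarrow> a \<circ> antipode \<in> coord_algebra q"

lemma coord_algebra_coproduct:
  assumes "a \<in> coord_algebra q"
  shows "\<exists>bs. set bs \<subseteq> coord_algebra q \<times> coord_algebra q \<and> is_coproduct a bs"
  using assms
proof induction
  case (u_coeff i j)
  then show ?case
    by (intro exI[of _ "map (\<lambda>a. (u_coeff q i a, u_coeff q a j)) [1, 2, 3]"] conjI is_coproduct_u_coeff)
      (auto intro!: coord_algebra.u_coeff)
next
  case counit
  show ?case
    by (intro exI[of _ "[(counit, counit)]"]) (auto simp: is_coproduct_def counit_mult intro: coord_algebra.counit)
next
  case (add a b)
  then obtain as bs where "set as \<subseteq> coord_algebra q \<times> coord_algebra q" "is_coproduct a as"
    "set bs \<subseteq> coord_algebra q \<times> coord_algebra q" "is_coproduct b bs" by blast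
  then show ?case
    by (intro exI[of _ "as @ bs"]) (auto simp: is_coproduct_def)
next
  case (scale a c)
  then obtain as where "set as \<subseteq> coord_algebra q \<times> coord_algebra q" "is_coproduct a as" by blast
  then show ?case
    by (intro exI[of _ "map (\<lambda>(b, d). (\<lambda>X. c * b X, d)) as"])
      (auto simp: is_coproduct_def case_prod_unfold o_def mult.assoc sum_list_const_mult dest!: subsetD intro: coord_algebra.scale)
next
  case (convolution a b)
  then obtain as bs where *: "set as \<subseteq> coord_algebra q \<times> coord_algebra q" "is_coproduct a as"
    "set bs \<subseteq> coord_algebra q \<times> coord_algebra q" "is_coproduct b bs" by blast
  show ?case
    using *(1,3) by (intro exI conjI, rule_tac[2] is_coproduct_convolution[OF *(2,4)])
      (auto intro!: coord_algebra.convolution)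
next
  case (antipode a)
  then obtain as where *: "set as \<subseteq> coord_algebra q \<times> coord_algebra q" "is_coproduct a as" by blast
  show ?case
    using *(1) by (intro exI conjI, rule_tac[2] is_coproduct_antipode[OF *(2)])
      (auto intro!: coord_algebra.antipode)
qed

context quantum_parameter
begin

lemma coord_algebra_subset: "coord_algebra q \<subseteq> Uq_dual q"
proof
  fix a assume "a \<in> coord_algebra q"
  then show "a \<in> Uq_dual q"
  proof induction
    case (add a b)
    then show ?case using Uq_dual_closed(1)[of a q b] by (simp add: plus_fun_def)
  next
    case (scale a c)
    then show ?case using Uq_dual_closed(2)[of a q c] by (simp add: scale_def)
  qed (simp_all add: u_coeff_in_Uq_dual counit_in_Uq_dual convolution_in_Uq_dual antipode_in_Uq_dual[unfolded o_def])
qed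

lemma Oq_SU3_eq: "Oq_SU3 q = coord_algebra q"
proof
  have "coord_algebra q \<subseteq> Hopf_dual q"
    unfolding Hopf_dual_def using coord_algebra_subset coord_algebra_coproduct[of _ q]
    by (smt (verit, ccfv_threshold) Sigma_mono mem_Collect_eq order_trans subset_iff)
  then have "Hopf_subalgebra q (coord_algebra q)"
    unfolding Hopf_subalgebra_def
    by (auto intro: coord_algebra.intros coord_algebra_coproduct)
  then show "Oq_SU3 q \<subseteq> coord_algebra q"
    unfolding Oq_SU3_def using coord_algebra.u_coeff[of _ _ q] by (intro Inter_lower) auto
  show "coord_algebra q \<subseteq> Oq_SU3 q"
    unfolding Oq_SU3_def
  proof (intro Inter_greatest subsetI)
    fix H a assume H: "H \<in> {H. Hopf_subalgebra q H \<and> (\<forall>i\<in>{1..3}. \<forall>j\<in>{1..3}. u_coeff q i j \<in> H)}"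
      and "a \<in> coord_algebra q"
    from this(2) show "a \<in> H"
      by induction (use H in \<open>auto simp: Hopf_subalgebra_def o_def\<close>)
  qed
qed

end

section \<open>Weights and a dual basis of the tangent space\<close>

text \<open>\<open>Inl\<close> stands for E and e, \<open>Inr\<close> for F and f. One index type
  for all six root vectors turns elements of degree two into square matrices of
  coefficients.\<close>

type_synonym tangent_index = "pos_root + pos_root"

fun root_vec :: "real \<Rightarrow> tangent_index \<Rightarrow> ualg" where
  "root_vec q (Inl \<gamma>) = root_E q \<gamma>"
| "root_vec q (Inr \<gamma>) = root_F q \<gamma>"

text \<open>Conjugation by K with index \<open>i\<close> multiplies the root vector by q to this
  power.\<close>

fun weight :: "tangent_index \<Rightarrow> node \<Rightarrow> int" where
  "weight (Inl \<gamma>) i = (\<Sum>j\<in>{N1, N2}. root_coeff \<gamma> j * cartan i j)"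
| "weight (Inr \<gamma>) i = - (\<Sum>j\<in>{N1, N2}. root_coeff \<gamma> j * cartan i j)"

lemma tangent_index_cases:
  obtains "s = Inl Alpha1" | "s = Inl Alpha2" | "s = Inl Alpha12"
  | "s = Inr Alpha1" | "s = Inr Alpha2" | "s = Inr Alpha12"
  by (cases s; rename_tac \<gamma>; case_tac \<gamma>) auto

lemma weight_inject: "weight s = weight t \<longleftrightarrow> s = t"
proof
  assume "weight s = weight t"
  then have "weight s N1 = weight t N1" "weight s N2 = weight t N2" by simp_all
  then show "s = t"
    by (cases s; cases t; rename_tac \<beta> \<gamma>; case_tac \<beta>; case_tac \<gamma>) simp_all
qed simp

lemma pair_eval_single_mult:
  "pair_eval a b (Poly_Mapping.single (v, w) 1 * t)
    = pair_eval (right_act (Poly_Mapping.single v 1) a) (right_act (Poly_Mapping.single w 1) b) t"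
proof (induction t rule: poly_mapping_linear_induct)
  case (single x c)
  show ?case by (cases x) (simp add: mult_single pair_eval_single right_act_def plus_prod_def)
qed (simp add: distrib_left pair_eval_add)

lemma right_act_K_convolution:
  "right_act (K\<^sub>U i) (convolution a b) = convolution (right_act (K\<^sub>U i) a) (right_act (K\<^sub>U i) b)"
  unfolding letter_def
  by (auto simp: fun_eq_iff right_act_def[of _ "convolution a b"] convolution_eq_pair_eval coproduct_mult
      coproduct_letter[unfolded letter_def] pair_eval_single_mult)

context quantum_parameter
begin

abbreviation rv :: "tangent_index \<Rightarrow> functional \<Rightarrow> functional" where
  "rv s \<equiv> left_act (root_vec q s)"

text \<open>A real number other than 0, 1, -1 is not a root of unity, as its absolute value shows;
  so eigenvalues of the K determine integral weights.\<close>

lemma qpow_inject: "qpow q m = qpow q n \<longleftrightarrow> m = n"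
proof
  have *: False if "k > 0" "qpow q k = 1" for k :: int
  proof -
    have "qpow q k = complex_of_real q ^ nat k"
      using that by (metis less_imp_le int_nat_eq power_int_of_nat)
    then have "complex_of_real (q ^ nat k) = complex_of_real 1" using that by simp
    then have "\<bar>q\<bar> ^ nat k = 1" by (metis abs_1 of_real_eq_iff power_abs)
    then have "\<bar>q\<bar> = 1" using that(1) power_eq_imp_eq_base[of "\<bar>q\<bar>" "nat k" 1] by simp
    then show False using generic by auto
  qed
  assume "qpow q m = qpow q n"
  then have "qpow q (m - n) = 1" "qpow q (n - m) = 1" by (simp_all add: power_int_diff)
  then show "m = n" using *[of "m - n"] *[of "n - m"] by (cases m n rule: linorder_cases) auto
qed simp

lemma left_K_root:
  assumes "a \<in> Uq_dual q"
  shows "left_act (K\<^sub>U i) (rv s a) = scale (qpow q (weight s i)) (rv s (left_act (K\<^sub>U i) a))"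
proof -
  define Q where "Q = complex_of_real q"
  have Q: "Q \<noteq> 0" by (simp add: Q_def)
  note simps = assms Q left_act_linear linear_functional_left_act Uq_dual_linear[OF assms] left_act_mult
    left_rewrite power_int_minus Q_def[symmetric] linear_functional_closed root_F_simple root_F_Alpha12
  show ?thesis
  proof (cases s)
    case (Inl \<gamma>)
    show ?thesis unfolding Inl
      by (cases \<gamma>; cases i) (auto simp: simps fun_eq_iff field_simps power2_eq_square)
  next
    case (Inr \<gamma>)
    show ?thesis unfolding Inr
      by (cases \<gamma>; cases i) (auto simp: simps fun_eq_iff field_simps power2_eq_square)
  qed
qed

text \<open>Evaluate \<open>y\<close> at \<open>K\<^sub>U i * X\<close>, where \<open>X\<close> is a
  root vector or a product of two. The weight of \<open>y\<close> produces q^m; moving K to the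
  right end, where \<open>y\<close> ignores it, produces q to the weight of \<open>X\<close>. A
  nonzero value of \<open>y\<close> at \<open>X\<close> forces equal exponents.\<close>

lemma weight_eqI:
  assumes y: "y \<in> Uq_dual q" and inv: "left_act (K\<^sub>U i) y = y"
    and wt: "right_act (K\<^sub>U i) y = scale (qpow q m) y"
  shows "y (root_vec q s) \<noteq> 0 \<Longrightarrow> m = weight s i"
    and "y (root_vec q s * root_vec q t) \<noteq> 0 \<Longrightarrow> m = weight s i + weight t i"
proof -
  have *: "left_act (K\<^sub>U i) (left_act X y) 1 = qpow q m * y X" for X
    using fun_cong[OF wt, of X] by (simp add: left_act_def right_act_def)
  show "m = weight s i" if "y (root_vec q s) \<noteq> 0"
    using *[of "root_vec q s"] left_K_root[OF y, of i s] that
    by (simp add: inv left_act_apply_1 qpow_inject)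
  show "m = weight s i + weight t i" if "y (root_vec q s * root_vec q t) \<noteq> 0"
    using *[of "root_vec q s * root_vec q t"] left_K_root[OF y, of i t]
      left_K_root[OF Uq_dual_closed(3)[OF y], of i s] that
    by (simp add: inv left_act_mult scale_vector qpow_inject flip: power_int_add)
      (simp add: left_act_def qpow_inject flip: power_int_add mult.assoc)
qed

text \<open>Under \<open>left_act\<close> of K the two factors have inverse eigenvalues, both
  depending on the column \<open>j\<close>, so the product lies in B. Under \<open>right_act\<close>
  row and column both remain; for \<open>i \<noteq> j\<close> they give the weight of a
  root.\<close>

definition coord_product :: "nat \<Rightarrow> nat \<Rightarrow> functional" where
  "coord_product i j = convolution (u_coeff q i j) (u_coeff q j j \<circ> antipode)"

lemma coord_product_in_Oq_SU3:
  "i \<in> {1..3} \<Longrightarrow> j \<in> {1..3} \<Longrightarrow> coord_product i j \<in> Oq_SU3 q"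
  unfolding Oq_SU3_eq coord_product_def
  by (intro coord_algebra.convolution coord_algebra.antipode coord_algebra.u_coeff)

lemma K_u_coeff:
  assumes "i \<in> {1..3}" "j \<in> {1..3}"
  shows
  "left_act (K\<^sub>U k) (u_coeff q i j) = scale (gen_u q (GK k) j j) (u_coeff q i j)"
  "left_act (Kinv\<^sub>U k) (u_coeff q i j) = scale (gen_u q (GKinv k) j j) (u_coeff q i j)"
  "left_act (K\<^sub>U k) (u_coeff q i j \<circ> antipode) = scale (gen_u q (GKinv k) i i) (u_coeff q i j \<circ> antipode)"
  "left_act (Kinv\<^sub>U k) (u_coeff q i j \<circ> antipode) = scale (gen_u q (GK k) i i) (u_coeff q i j \<circ> antipode)"
  "right_act (K\<^sub>U k) (u_coeff q i j) = scale (gen_u q (GK k) i i) (u_coeff q i j)"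
  "right_act (K\<^sub>U k) (u_coeff q i j \<circ> antipode) = scale (gen_u q (GKinv k) j j) (u_coeff q i j \<circ> antipode)"
proof -
  have "i \<in> {1, 2, 3}" "j \<in> {1, 2, 3}" using assms by auto
  then show "left_act (K\<^sub>U k) (u_coeff q i j) = scale (gen_u q (GK k) j j) (u_coeff q i j)"
  "left_act (Kinv\<^sub>U k) (u_coeff q i j) = scale (gen_u q (GKinv k) j j) (u_coeff q i j)"
  "left_act (K\<^sub>U k) (u_coeff q i j \<circ> antipode) = scale (gen_u q (GKinv k) i i) (u_coeff q i j \<circ> antipode)"
  "left_act (Kinv\<^sub>U k) (u_coeff q i j \<circ> antipode) = scale (gen_u q (GK k) i i) (u_coeff q i j \<circ> antipode)"
  "right_act (K\<^sub>U k) (u_coeff q i j) = scale (gen_u q (GK k) i i) (u_coeff q i j)"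
  "right_act (K\<^sub>U k) (u_coeff q i j \<circ> antipode) = scale (gen_u q (GKinv k) j j) (u_coeff q i j \<circ> antipode)"
    using assms
    by (auto simp: fun_eq_iff left_act_def right_act_def antipode_mult antipode_letter u_coeff_mult u_coeff_letter
        atLeastAtMost_1_3)
qed

lemma gen_u_K_inverse: "gen_u q (GK k) j j * gen_u q (GKinv k) j j = 1"
  by (simp add: power_int_minus)

lemma coord_product_in_Oq_F3:
  assumes "i \<in> {1..3}" "j \<in> {1..3}"
  shows "coord_product i j \<in> Oq_F3 q"
  using assms coord_product_in_Oq_SU3[OF assms] gen_u_K_inverse[of _ j]
  by (simp add: Oq_F3_def coord_product_def left_act_convolution K_u_coeff convolution_scale scale_vector
      mult.commute del: gen_u.simps atLeastAtMost_iff)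

lemma right_K_coord_product:
  assumes "i \<in> {1..3}" "j \<in> {1..3}"
  shows "right_act (K\<^sub>U k) (coord_product i j)
    = scale (gen_u q (GK k) i i * gen_u q (GKinv k) j j) (coord_product i j)"
  using assms
  by (simp add: coord_product_def right_act_K_convolution K_u_coeff convolution_scale scale_vector
      mult.commute del: gen_u.simps atLeastAtMost_iff)

text \<open>The only nonzero entry of the root vector in the three-dimensional
  representation.\<close>

fun matrix_position :: "tangent_index \<Rightarrow> nat \<times> nat" where
  "matrix_position (Inl Alpha1) = (2, 1)"
| "matrix_position (Inl Alpha2) = (3, 2)"
| "matrix_position (Inl Alpha12) = (3, 1)"
| "matrix_position (Inr Alpha1) = (1, 2)"
| "matrix_position (Inr Alpha2) = (2, 3)"
| "matrix_position (Inr Alpha12) = (1, 3)"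

text \<open>Nonvanishing is enough, because \<open>dual_functional\<close> divides by the
  value.\<close>

lemma coord_product_root_vec:
  "(case matrix_position s of (i, j) \<Rightarrow> coord_product i j) (root_vec q s) \<noteq> 0"
proof -
  define Q where "Q = complex_of_real q"
  have Q: "Q \<noteq> 0" by (simp add: Q_def)
  let ?z = "case matrix_position s of (i, j) \<Rightarrow> coord_product i j"
  have "left_act (root_vec q s) ?z 1 \<noteq> 0"
    by (cases s rule: tangent_index_cases)
      (simp_all add: coord_product_def left_act_linear linear_functional_convolution linear_functional_left_act
        left_act_mult left_act_convolution K_u_coeff convolution_vector convolution_1 scale_vector
        root_F_simple root_F_Alpha12 linear_functional_closed u_coeff_1 power_int_minus Q_def[symmetric] Q,
       simp_all add: left_act_def u_coeff_mult u_coeff_letter atLeastAtMost_1_3 antipode_1 u_coeff_1 Q)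
  then show ?thesis by (simp add: left_act_apply_1)
qed

lemma matrix_position_weight:
  "(case matrix_position s of (i, j) \<Rightarrow> gen_u q (GK k) i i * gen_u q (GKinv k) j j) = qpow q (weight s k)"
  by (cases s rule: tangent_index_cases; cases k) (simp_all add: power_int_minus power2_eq_square)

definition dual_functional :: "tangent_index \<Rightarrow> functional" where
  "dual_functional s = (let z = (case matrix_position s of (i, j) \<Rightarrow> coord_product i j)
     in scale (inverse (z (root_vec q s))) z)"

lemma Oq_F3_scale: "b \<in> Oq_F3 q \<Longrightarrow> scale c b \<in> Oq_F3 q"
  using coord_algebra.scale[of b q c] by (simp add: Oq_F3_def Oq_SU3_eq scale_def left_act_def fun_eq_iff)

lemma Oq_F3_add: "b \<in> Oq_F3 q \<Longrightarrow> c \<in> Oq_F3 q \<Longrightarrow> b + c \<in> Oq_F3 q"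
  using coord_algebra.add[of b q c] by (simp add: Oq_F3_def Oq_SU3_eq plus_fun_def left_act_def fun_eq_iff)

lemma Oq_F3_D:
  assumes "b \<in> Oq_F3 q"
  shows "b \<in> Uq_dual q" "left_act (K\<^sub>U i) b = b" "left_act (Kinv\<^sub>U i) b = b" "b \<in> Oq_SU3 q"
  using assms coord_algebra_subset by (auto simp: Oq_F3_def Oq_SU3_eq)

lemma Oq_F3_convolution: "b \<in> Oq_F3 q \<Longrightarrow> c \<in> Oq_F3 q \<Longrightarrow> convolution b c \<in> Oq_F3 q"
  by (simp add: Oq_F3_def Oq_SU3_eq left_act_convolution coord_algebra.convolution)

lemma dual_functional:
  "dual_functional s \<in> Oq_F3 q" "dual_functional s 1 = 0"
  "right_act (K\<^sub>U i) (dual_functional s) = scale (qpow q (weight s i)) (dual_functional s)"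
proof -
  obtain i j where ij: "matrix_position s = (i, j)" by fastforce
  have range: "i \<in> {1..3}" "j \<in> {1..3}" "i \<noteq> j"
    using ij by (cases s rule: tangent_index_cases; simp)+
  show "dual_functional s \<in> Oq_F3 q"
    unfolding dual_functional_def using range by (simp add: ij Let_def Oq_F3_scale coord_product_in_Oq_F3 del: atLeastAtMost_iff)
  show "dual_functional s 1 = 0"
    using range by (simp add: dual_functional_def ij Let_def coord_product_def convolution_1 u_coeff_1)
  show "right_act (K\<^sub>U k) (dual_functional s) = scale (qpow q (weight s k)) (dual_functional s)" for k
    using range matrix_position_weight[where s = s and k = k]
    by (simp add: dual_functional_def ij right_K_coord_product scale_vector mult.commute Let_def del: atLeastAtMost_iff gen_u.simps)
qed

text \<open>The six weights are distinct, and a functional in B of a given weight vanishes on root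
  vectors of any other weight.\<close>

lemma dual_functional_root_vec: "dual_functional s (root_vec q t) = of_bool (s = t)"
proof (cases "s = t")
  case True
  then show ?thesis using coord_product_root_vec[of s] by (simp add: dual_functional_def Let_def)
next
  case False
  then have "weight s \<noteq> weight t" by (simp add: weight_inject)
  then obtain i where "weight s i \<noteq> weight t i" by (meson ext)
  then have "dual_functional s (root_vec q t) = 0"
    using weight_eqI(1)[OF Oq_F3_D(1,2)[OF dual_functional(1)] dual_functional(3)] by blast
  then show ?thesis using False by simp
qed

section \<open>Values on products of two root vectors\<close>

lemma dual_functional_root_vec_mult:
  assumes "weight s i + weight t i \<noteq> weight r i"
  shows "dual_functional r (root_vec q s * root_vec q t) = 0"
  using weight_eqI(2)[OF Oq_F3_D(1,2)[OF dual_functional(1)] dual_functional(3)] assms by metis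


text \<open>For simple roots, E and K F have coproducts of the same shape. At \<alpha>_1 +
  \<alpha>_2 two mixed terms arise. Moving K past the simple root vectors cancels the one with index
  2 in the first leg and leaves the other with coefficient 1 - q^(-2), or \<nu> in the case of
  F.\<close>

lemma rv_convolution:
  assumes "a \<in> Uq_dual q" "b \<in> Uq_dual q"
  shows
  "rv (Inl Alpha1) (convolution a b)
    = convolution (rv (Inl Alpha1) a) (left_act (K\<^sub>U N1) b) + convolution a (rv (Inl Alpha1) b)"
  "rv (Inl Alpha2) (convolution a b)
    = convolution (rv (Inl Alpha2) a) (left_act (K\<^sub>U N2) b) + convolution a (rv (Inl Alpha2) b)"
  "rv (Inl Alpha12) (convolution a b)
    = convolution (rv (Inl Alpha12) a) (left_act (K\<^sub>U N1) (left_act (K\<^sub>U N2) b)) + convolution a (rv (Inl Alpha12) b)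
      + scale (1 - qpow q (-2)) (convolution (rv (Inl Alpha1) a) (rv (Inl Alpha2) (left_act (K\<^sub>U N1) b)))"
  "rv (Inr Alpha1) (convolution a b)
    = convolution (rv (Inr Alpha1) a) (left_act (K\<^sub>U N1) b) + convolution a (rv (Inr Alpha1) b)"
  "rv (Inr Alpha2) (convolution a b)
    = convolution (rv (Inr Alpha2) a) (left_act (K\<^sub>U N2) b) + convolution a (rv (Inr Alpha2) b)"
  "rv (Inr Alpha12) (convolution a b)
    = convolution (rv (Inr Alpha12) a) (left_act (K\<^sub>U N1) (left_act (K\<^sub>U N2) b)) + convolution a (rv (Inr Alpha12) b)
      + scale (nu q) (convolution (rv (Inr Alpha1) a) (rv (Inr Alpha2) (left_act (K\<^sub>U N1) b)))"
proof -
  define Q where "Q = complex_of_real q"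
  have Q: "Q \<noteq> 0" by (simp add: Q_def)
  note simps = assms Q left_act_linear linear_functional_left_act Uq_dual_linear[OF assms(1)] Uq_dual_linear[OF assms(2)]
    linear_functional_convolution convolution_in_Uq_dual left_act_mult left_act_convolution convolution_vector
    left_rewrite power_int_minus Q_def[symmetric] linear_functional_closed root_F_simple root_F_Alpha12
  show
  "rv (Inl Alpha1) (convolution a b)
    = convolution (rv (Inl Alpha1) a) (left_act (K\<^sub>U N1) b) + convolution a (rv (Inl Alpha1) b)"
  "rv (Inl Alpha2) (convolution a b)
    = convolution (rv (Inl Alpha2) a) (left_act (K\<^sub>U N2) b) + convolution a (rv (Inl Alpha2) b)"
    by (simp_all add: simps)
  show
  "rv (Inr Alpha1) (convolution a b)
    = convolution (rv (Inr Alpha1) a) (left_act (K\<^sub>U N1) b) + convolution a (rv (Inr Alpha1) b)"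
  "rv (Inr Alpha2) (convolution a b)
    = convolution (rv (Inr Alpha2) a) (left_act (K\<^sub>U N2) b) + convolution a (rv (Inr Alpha2) b)"
    by (simp_all add: simps)
  show
  "rv (Inl Alpha12) (convolution a b)
    = convolution (rv (Inl Alpha12) a) (left_act (K\<^sub>U N1) (left_act (K\<^sub>U N2) b)) + convolution a (rv (Inl Alpha12) b)
      + scale (1 - qpow q (-2)) (convolution (rv (Inl Alpha1) a) (rv (Inl Alpha2) (left_act (K\<^sub>U N1) b)))"
    by (simp add: simps) (auto simp: simps fun_eq_iff field_simps power2_eq_square)
  show
  "rv (Inr Alpha12) (convolution a b)
    = convolution (rv (Inr Alpha12) a) (left_act (K\<^sub>U N1) (left_act (K\<^sub>U N2) b)) + convolution a (rv (Inr Alpha12) b)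
      + scale (nu q) (convolution (rv (Inr Alpha1) a) (rv (Inr Alpha2) (left_act (K\<^sub>U N1) b)))"
    by (simp add: simps) (auto simp: simps fun_eq_iff field_simps power2_eq_square)
qed

text \<open>The left-hand monomials of the relations, 6 + 6 + 9 pairs. At the other positions
  \<open>annihilator_relations\<close> expresses the coordinates by those at leading ones.\<close>

definition leading :: "(tangent_index \<times> tangent_index) set" where
  "leading = {(Inl \<gamma>, Inl \<beta>) | \<beta> \<gamma>. \<beta> \<le> \<gamma>} \<union> {(Inr \<gamma>, Inr \<beta>) | \<beta> \<gamma>. \<beta> \<le> \<gamma>} \<union> {(Inl \<gamma>, Inr \<beta>) | \<beta> \<gamma>. True}"

text \<open>On the diagonal both sides of the relation are the same monomial; collected on one side
  they give 1 + q^2 for e and 1 + q^(-2) for f.\<close>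

definition leading_coeff :: "tangent_index \<Rightarrow> tangent_index \<Rightarrow> complex" where
  "leading_coeff s t = (if s = t then 1 + qpow q (case s of Inl _ \<Rightarrow> 2 | Inr _ \<Rightarrow> - 2) else 1)"

text \<open>The factors are in reverse order: \<open>z\<^sub>\<alpha>\<^sub>1 z\<^sub>\<alpha>\<^sub>2\<close> does not vanish on \<open>E\<^sub>\<alpha>\<close> for \<open>\<alpha> = \<alpha>\<^sub>1 + \<alpha>\<^sub>2\<close>, whereas
  \<open>z\<^sub>\<alpha>\<^sub>2 z\<^sub>\<alpha>\<^sub>1\<close> does.\<close>

abbreviation dual_product :: "tangent_index \<Rightarrow> tangent_index \<Rightarrow> functional" where
  "dual_product s t \<equiv> convolution (dual_functional t) (dual_functional s)"

lemma rv_dual_functional_1: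
  "rv s (dual_functional t) 1 = of_bool (t = s)"
  "weight s i + weight t i \<noteq> weight r i \<Longrightarrow> rv s (rv t (dual_functional r)) 1 = 0"
  by (simp_all only: left_act_apply_1 dual_functional_root_vec dual_functional_root_vec_mult flip: left_act_mult)

lemma dual_functional_Uq_dual: "dual_functional s \<in> Uq_dual q"
  and left_K_dual_functional: "left_act (K\<^sub>U i) (dual_functional s) = dual_functional s"
  using Oq_F3_D[OF dual_functional(1)] by blast+

text \<open>A nonzero value at a product needs matching weights at both nodes, so the vanishing rule
  is supplied for \<open>N1\<close> and for \<open>N2\<close>.\<close>

lemmas product_rewrite = rv_convolution left_K_root dual_functional_Uq_dual left_K_dual_functional
    convolution_1 convolution_vector dual_functional(2) rv_dual_functional_1(1)
    rv_dual_functional_1(2)[where i = N1] rv_dual_functional_1(2)[where i = N2]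

lemma leading_cases:
  assumes "(s, t) \<in> leading"
  obtains "s = Inl Alpha1" "t = Inl Alpha1" | "s = Inl Alpha1" "t = Inl Alpha2" | "s = Inl Alpha1" "t = Inl Alpha12"
    | "s = Inl Alpha2" "t = Inl Alpha2" | "s = Inl Alpha12" "t = Inl Alpha2" | "s = Inl Alpha12" "t = Inl Alpha12"
    | "s = Inr Alpha1" "t = Inr Alpha1" | "s = Inr Alpha1" "t = Inr Alpha2" | "s = Inr Alpha1" "t = Inr Alpha12"
    | "s = Inr Alpha2" "t = Inr Alpha2" | "s = Inr Alpha12" "t = Inr Alpha2" | "s = Inr Alpha12" "t = Inr Alpha12"
    | "s = Inl Alpha1" "t = Inr Alpha1" | "s = Inl Alpha1" "t = Inr Alpha2" | "s = Inl Alpha1" "t = Inr Alpha12"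
    | "s = Inl Alpha2" "t = Inr Alpha1" | "s = Inl Alpha2" "t = Inr Alpha2" | "s = Inl Alpha2" "t = Inr Alpha12"
    | "s = Inl Alpha12" "t = Inr Alpha1" | "s = Inl Alpha12" "t = Inr Alpha2" | "s = Inl Alpha12" "t = Inr Alpha12"
  using assms
  by (cases s rule: tangent_index_cases; cases t rule: tangent_index_cases)
    (auto simp: leading_def less_eq_pos_root_def)

text \<open>Dual functionals vanish at 1, which removes every term that leaves a factor untouched.
  The remaining mixed term at \<alpha>_1 + \<alpha>_2 needs \<open>t\<close> at \<alpha>_1 and
  \<open>s\<close> at \<alpha>_2, both of the same kind; the order excludes this.\<close>

lemma dual_product_root_vec:
  assumes "(s, t) \<in> leading"
  shows "dual_product s t (root_vec q r) = 0"
proof -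
  have "rv r (dual_product s t) 1 = 0"
    using assms
    by (cases rule: leading_cases; cases r rule: tangent_index_cases)
      (simp_all add: product_rewrite del: root_vec.simps)
  then show ?thesis by (simp add: left_act_apply_1)
qed

text \<open>For \<open>s \<noteq> t\<close> only the term with \<open>t\<close> on the first and
  \<open>s\<close> on the second factor survives. For \<open>s = t\<close> both distributions do,
  one of them with q^2 or q^(-2) from moving K past the root vector.\<close>

lemma dual_product_leading:
  assumes "(s, t) \<in> leading"
  shows "dual_product s t (root_vec q s * root_vec q t) = leading_coeff s t"
proof -
  have "rv s (rv t (dual_product s t)) 1 = leading_coeff s t"
    using assms
    by (cases rule: leading_cases)
      (simp_all add: product_rewrite leading_coeff_def power2_eq_square power_int_minus del: root_vec.simps)
  then show ?thesis by (simp add: left_act_apply_1 flip: left_act_mult)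
qed

text \<open>Different leading pairs have different total weights, except for the three pairs of e
  and f at a common root, all of weight zero. Those are computed directly; \<alpha>_1 + \<alpha>_2
  as target is exempt because the mixed terms of its Leibniz rules may contribute.\<close>

lemma dual_product_leading_zero:
  assumes "(s, t) \<in> leading" "(s', t') \<in> leading" "(s, t) \<noteq> (s', t')"
    and "\<not> (\<exists>\<gamma>. s = Inl \<gamma> \<and> t = Inr \<gamma> \<and> s' = Inl Alpha12 \<and> t' = Inr Alpha12)"
  shows "dual_product s t (root_vec q s' * root_vec q t') = 0"
proof (cases "\<exists>\<gamma> \<beta>. s = Inl \<gamma> \<and> t = Inr \<gamma> \<and> s' = Inl \<beta> \<and> t' = Inr \<beta>")
  case True
  then obtain \<gamma> \<beta> where st: "s = Inl \<gamma>" "t = Inr \<gamma>" "s' = Inl \<beta>" "t' = Inr \<beta>" "\<beta> \<noteq> Alpha12" "\<beta> \<noteq> \<gamma>"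
    using assms by auto
  have "rv s' (rv t' (dual_product s t)) 1 = 0"
    unfolding st using st(5,6)
    by (cases \<gamma>; cases \<beta>) (simp_all add: product_rewrite del: root_vec.simps)
  then show ?thesis by (simp add: left_act_apply_1 flip: left_act_mult)
next
  case False
  have "weight s N1 + weight t N1 \<noteq> weight s' N1 + weight t' N1 \<or> weight s N2 + weight t N2 \<noteq> weight s' N2 + weight t' N2"
    using assms(1)
    by (cases rule: leading_cases; use assms(2) in \<open>cases rule: leading_cases\<close>; use assms(3) False in simp)
  moreover have "right_act (K\<^sub>U i) (dual_product s t) = scale (qpow q (weight s i + weight t i)) (dual_product s t)" for i
    by (simp add: right_act_K_convolution dual_functional(3) convolution_scale scale_vector power_int_add mult.commute
        del: weight.simps)
  ultimately show ?thesis
    using weight_eqI(2)[OF Oq_F3_D(1,2)[OF Oq_F3_convolution[OF dual_functional(1) dual_functional(1)]]] by metis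
qed

text \<open>Both sides are brought to normal order, where \<open>y\<close> ignores K and kills 1 and
  the root vectors. The term with \<nu> is what then remains of the commutator of E and F at
  \<alpha>_1 + \<alpha>_2.\<close>

lemma annihilator_relations:
  assumes y: "y \<in> Oq_F3 q" "y 1 = 0" and ann: "\<And>s. y (root_vec q s) = 0"
  defines "M \<equiv> \<lambda>s t. y (root_vec q s * root_vec q t)"
  shows "\<beta> < \<gamma> \<Longrightarrow> M (Inl \<beta>) (Inl \<gamma>) = qpow q (root_form \<beta> \<gamma>) * M (Inl \<gamma>) (Inl \<beta>)"
    and "\<beta> < \<gamma> \<Longrightarrow> M (Inr \<beta>) (Inr \<gamma>) = qpow q (- root_form \<beta> \<gamma>) * M (Inr \<gamma>) (Inr \<beta>)"
    and "M (Inr \<beta>) (Inl \<gamma>) = qpow q (root_form \<beta> \<gamma>) * M (Inl \<gamma>) (Inr \<beta>)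
      + (if \<beta> = Alpha12 \<and> \<gamma> = Alpha12 then nu q * (M (Inl Alpha1) (Inr Alpha1) - M (Inl Alpha2) (Inr Alpha2)) else 0)"
proof -
  define Q where "Q = complex_of_real q"
  have Q: "Q \<noteq> 0" "Q * Q \<noteq> 1" by (simp_all add: Q_def)
  note yD = Oq_F3_D[OF y(1)]
  note simps = yD(1-3) Q left_act_linear linear_functional_left_act Uq_dual_linear[OF yD(1)] left_act_mult
    left_rewrite power_int_minus Q_def[symmetric] linear_functional_closed root_F_simple root_F_Alpha12
  have M: "M s t = rv s (rv t y) 1" for s t
    by (simp add: M_def left_act_apply_1 flip: left_act_mult)
  have ann': "rv s y 1 = 0" for s using ann by (simp add: left_act_apply_1)
  have E: "left_act (E\<^sub>U i) y 1 = 0" for i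
    using ann'[of "Inl Alpha1"] ann'[of "Inl Alpha2"] by (cases i) (simp_all add: simps)
  have F: "left_act (F\<^sub>U i) y 1 = 0" for i
    using ann'[of "Inr Alpha1"] ann'[of "Inr Alpha2"] by (cases i) (simp_all add: simps)
  \<comment> \<open>Vanishing on \<open>root_E q Alpha12\<close> does not kill the two products
    separately; it only eliminates one in favour of the other.\<close>
  have E12: "left_act (E\<^sub>U N2) (left_act (E\<^sub>U N1) y) 1 = left_act (E\<^sub>U N1) (left_act (E\<^sub>U N2) y) 1 / Q"
    using ann'[of "Inl Alpha12"] by (simp add: simps field_simps)
  have F12: "left_act (F\<^sub>U N2) (left_act (F\<^sub>U N1) y) 1 = Q * left_act (F\<^sub>U N1) (left_act (F\<^sub>U N2) y) 1"
    using ann'[of "Inr Alpha12"] by (simp add: simps field_simps power2_eq_square)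
  \<comment> \<open>Scalars become polynomials in q, its inverse \<open>P\<close> and the inverse
    \<open>N\<close> of \<nu>. The rules \<open>N1\<close> to \<open>N4\<close> and
    \<open>PQ\<close> follow from Q P = 1 and (Q - P) N = 1 and reduce such polynomials without
    clearing denominators.\<close>
  define N where "N = inverse (Q - inverse Q)"
  define P where "P = inverse Q"
  have "Q - P \<noteq> 0" using Q by (simp add: P_def field_simps)
  then have N1: "Q * N = 1 + P * N" by (simp add: N_def P_def[symmetric]) (simp add: field_simps)
  have N2: "Q * (N * x) = x + P * (N * x)" for x using N1 by (simp add: distrib_right flip: mult.assoc)
  have N3: "N * (P * P) = N - P" using N1 Q by (simp add: P_def field_simps)
  have N4: "N * (P * (P * x)) = N * x - P * x" for x using N3 by (simp add: left_diff_distrib flip: mult.assoc)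
  have PQ: "Q * P = 1" "Q * (P * x) = x" "P * (Q * x) = x" for x using Q by (simp_all add: P_def)
  have P: "inverse (Q\<^sup>2) = P * P" "inverse Q = P" "inverse (Q - P) = N" by (simp_all add: P_def N_def power2_eq_square)
  have "(\<beta>, \<gamma>) \<in> {(Alpha2, Alpha12), (Alpha2, Alpha1), (Alpha12, Alpha1)}" if "\<beta> < \<gamma>"
    using that by (cases \<beta>; cases \<gamma>) (simp_all add: less_pos_root_def)
  moreover have "M (Inl Alpha2) (Inl Alpha12) = qpow q (root_form Alpha2 Alpha12) * M (Inl Alpha12) (Inl Alpha2)"
    "M (Inl Alpha2) (Inl Alpha1) = qpow q (root_form Alpha2 Alpha1) * M (Inl Alpha1) (Inl Alpha2)"
    "M (Inl Alpha12) (Inl Alpha1) = qpow q (root_form Alpha12 Alpha1) * M (Inl Alpha1) (Inl Alpha12)"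
    "M (Inr Alpha2) (Inr Alpha12) = qpow q (- root_form Alpha2 Alpha12) * M (Inr Alpha12) (Inr Alpha2)"
    "M (Inr Alpha2) (Inr Alpha1) = qpow q (- root_form Alpha2 Alpha1) * M (Inr Alpha1) (Inr Alpha2)"
    "M (Inr Alpha12) (Inr Alpha1) = qpow q (- root_form Alpha12 Alpha1) * M (Inr Alpha1) (Inr Alpha12)"
    unfolding M
    by (simp add: root_form_def simps; (simp add: E F E12 F12 y P power2_eq_square divide_inverse)?;
        (simp add: algebra_simps N1 N2 N3 N4 PQ)?)+
  ultimately show "\<beta> < \<gamma> \<Longrightarrow> M (Inl \<beta>) (Inl \<gamma>) = qpow q (root_form \<beta> \<gamma>) * M (Inl \<gamma>) (Inl \<beta>)"
    and "\<beta> < \<gamma> \<Longrightarrow> M (Inr \<beta>) (Inr \<gamma>) = qpow q (- root_form \<beta> \<gamma>) * M (Inr \<gamma>) (Inr \<beta>)"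
    by blast+
  show "M (Inr \<beta>) (Inl \<gamma>) = qpow q (root_form \<beta> \<gamma>) * M (Inl \<gamma>) (Inr \<beta>)
      + (if \<beta> = Alpha12 \<and> \<gamma> = Alpha12 then nu q * (M (Inl Alpha1) (Inr Alpha1) - M (Inl Alpha2) (Inr Alpha2)) else 0)"
    unfolding M
    by (cases \<beta>; cases \<gamma>; hypsubst; simp add: root_form_def simps; (simp add: E F E12 F12 y P power2_eq_square divide_inverse)?;
        (simp add: algebra_simps N1 N2 N3 N4 PQ)?)
qed

end

section \<open>Tensor algebras\<close>

lemma free_algebra_carrier:
  "letter v \<in> carrier (free_algebra A) \<longleftrightarrow> v \<in> A"
  "scalar c \<in> carrier (free_algebra A)"
  "0 \<in> carrier (free_algebra A)"
  "p \<in> carrier (free_algebra A) \<Longrightarrow> r \<in> carrier (free_algebra A) \<Longrightarrow> p + r \<in> carrier (free_algebra A)"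
  "p \<in> carrier (free_algebra A) \<Longrightarrow> r \<in> carrier (free_algebra A) \<Longrightarrow> p * r \<in> carrier (free_algebra A)"
  "p \<in> carrier (free_algebra A) \<Longrightarrow> - p \<in> carrier (free_algebra A)"
  "p \<in> carrier (free_algebra A) \<Longrightarrow> r \<in> carrier (free_algebra A) \<Longrightarrow> p - r \<in> carrier (free_algebra A)"
proof -
  interpret ring "free_algebra A" by (rule ring_free_algebra)
  show "letter v \<in> carrier (free_algebra A) \<longleftrightarrow> v \<in> A" by (simp add: free_algebra_def letter_def)
  show "scalar c \<in> carrier (free_algebra A)" by (simp add: free_algebra_def scalar_def zero_fword_def)
  show "0 \<in> carrier (free_algebra A)" by (simp add: free_algebra_def)
  show add: "p \<in> carrier (free_algebra A) \<Longrightarrow> r \<in> carrier (free_algebra A) \<Longrightarrow> p + r \<in> carrier (free_algebra A)" for p r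
    using add.m_closed[of p r] by (simp add: free_algebra_simps)
  show "p \<in> carrier (free_algebra A) \<Longrightarrow> r \<in> carrier (free_algebra A) \<Longrightarrow> p * r \<in> carrier (free_algebra A)"
    using m_closed[of p r] by (simp add: free_algebra_simps)
  show minus: "p \<in> carrier (free_algebra A) \<Longrightarrow> - p \<in> carrier (free_algebra A)" for p
    by (simp add: free_algebra_def)
  show "p \<in> carrier (free_algebra A) \<Longrightarrow> r \<in> carrier (free_algebra A) \<Longrightarrow> p - r \<in> carrier (free_algebra A)"
    using add[of p "- r"] minus[of r] by simp
qed

lemma free_algebra_carrier_sum:
  "(\<And>i. i \<in> S \<Longrightarrow> f i \<in> carrier (free_algebra A)) \<Longrightarrow> (\<Sum>i\<in>S. f i) \<in> carrier (free_algebra A)"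
  by (induction S rule: infinite_finite_induct) (auto simp: free_algebra_carrier)

locale closed_operations =
  fixes V :: "(complex, 'v, 'm) module_scheme"
  assumes add_closed: "v \<in> carrier V \<Longrightarrow> w \<in> carrier V \<Longrightarrow> v \<oplus>\<^bsub>V\<^esub> w \<in> carrier V"
    and smult_closed: "v \<in> carrier V \<Longrightarrow> c \<odot>\<^bsub>V\<^esub> v \<in> carrier V"
begin

abbreviation "FV \<equiv> free_algebra (carrier V)"

text \<open>The quotient map onto the tensor algebra; calculations then take place on
  representatives in the free algebra.\<close>

definition proj :: "'v falg \<Rightarrow> 'v falg set" where
  "proj p = tensor_ideal V +>\<^bsub>FV\<^esub> p"

lemma linearity_relators_carrier: "linearity_relators V \<subseteq> carrier FV"
  by (auto simp: linearity_relators_def add_closed smult_closed intro!: free_algebra_carrier(4,5,7)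
      free_algebra_carrier(2) free_algebra_carrier(1)[THEN iffD2])

lemma tensor_ideal: "ideal (tensor_ideal V) FV"
  unfolding tensor_ideal_def
  by (rule ring.genideal_ideal[OF ring_free_algebra linearity_relators_carrier])

lemma proj_hom: "ring_hom_ring FV (tensor_algebra V) proj"
  using ideal.rcos_ring_hom_ring[OF tensor_ideal] by (simp add: tensor_algebra_def proj_def[abs_def])

lemma ring_tensor_algebra: "ring (tensor_algebra V)"
  unfolding tensor_algebra_def by (rule ideal.quotient_is_ring[OF tensor_ideal])

lemma proj_closed: "p \<in> carrier FV \<Longrightarrow> proj p \<in> carrier (tensor_algebra V)"
  using ring_hom_ring.homh[OF proj_hom] by (rule ring_hom_closed)

lemma proj_add:
  "p \<in> carrier FV \<Longrightarrow> r \<in> carrier FV \<Longrightarrow> proj p \<oplus>\<^bsub>tensor_algebra V\<^esub> proj r = proj (p + r)"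
  using ring_hom_add[OF ring_hom_ring.homh[OF proj_hom]] by (simp add: free_algebra_simps)

lemma proj_mult:
  "p \<in> carrier FV \<Longrightarrow> r \<in> carrier FV \<Longrightarrow> proj p \<otimes>\<^bsub>tensor_algebra V\<^esub> proj r = proj (p * r)"
  using ring_hom_mult[OF ring_hom_ring.homh[OF proj_hom]] by (simp add: free_algebra_simps)

lemma proj_zero: "\<zero>\<^bsub>tensor_algebra V\<^esub> = proj 0"
  using ring_hom_zero[OF ring_hom_ring.homh[OF proj_hom] ring_free_algebra ring_tensor_algebra]
  by (simp add: free_algebra_simps)

lemma proj_minus:
  assumes "p \<in> carrier FV" "r \<in> carrier FV"
  shows "proj p \<ominus>\<^bsub>tensor_algebra V\<^esub> proj r = proj (p - r)"
proof -
  interpret ring_hom_ring FV "tensor_algebra V" proj by (rule proj_hom)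
  have "proj p \<ominus>\<^bsub>tensor_algebra V\<^esub> proj r = proj p \<oplus>\<^bsub>tensor_algebra V\<^esub> proj (- r)"
    using assms by (simp add: a_minus_def free_algebra_a_inv flip: hom_a_inv)
  then show ?thesis using assms by (simp add: proj_add free_algebra_carrier)
qed

lemma proj_smult:
  "p \<in> carrier FV \<Longrightarrow> tensor_smult V c (proj p) = proj (scalar c * p)"
  by (simp add: tensor_smult_def proj_mult free_algebra_carrier flip: proj_def)

lemma tensor_vec_eq_proj: "tensor_vec V v = proj (letter v)"
  by (simp add: tensor_vec_def proj_def)

lemma proj_eqI:
  assumes "p \<in> carrier FV" "r \<in> carrier FV" "p - r \<in> tensor_ideal V"
  shows "proj p = proj r"
proof -
  have "p \<ominus>\<^bsub>FV\<^esub> r = p - r"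
    using assms by (simp add: a_minus_def free_algebra_a_inv free_algebra_simps)
  then show ?thesis
    using ring.quotient_eq_iff_same_a_r_cos[OF ring_free_algebra tensor_ideal assms(1,2)] assms(3)
    by (simp add: proj_def)
qed

lemma tensor_ideal_relators: "linearity_relators V \<subseteq> tensor_ideal V"
  unfolding tensor_ideal_def by (rule ring.genideal_self[OF ring_free_algebra linearity_relators_carrier])

lemma proj_letter_add:
  "v \<in> carrier V \<Longrightarrow> w \<in> carrier V \<Longrightarrow> proj (letter (v \<oplus>\<^bsub>V\<^esub> w)) = proj (letter v + letter w)"
  by (rule proj_eqI)
    (use tensor_ideal_relators in \<open>auto simp: free_algebra_carrier add_closed linearity_relators_def\<close>)

lemma proj_letter_smult:
  "v \<in> carrier V \<Longrightarrow> proj (letter (c \<odot>\<^bsub>V\<^esub> v)) = proj (scalar c * letter v)"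
  by (rule proj_eqI)
    (use tensor_ideal_relators in \<open>auto simp: free_algebra_carrier smult_closed linearity_relators_def\<close>)

lemma proj_add_cong:
  assumes "proj p = proj p'" "proj r = proj r'"
    and "p \<in> carrier FV" "p' \<in> carrier FV" "r \<in> carrier FV" "r' \<in> carrier FV"
  shows "proj (p + r) = proj (p' + r')"
  using assms by (simp flip: proj_add)

text \<open>Scalars are themselves elements of the tensor algebra, so a ring ideal is a
  subspace.\<close>

lemma ideal_proj_smult:
  assumes "ideal H (tensor_algebra V)" "proj p \<in> H" "p \<in> carrier FV"
  shows "proj (scalar c * p) \<in> H"
  using ideal.I_l_closed[OF assms(1,2) proj_closed[of "scalar c"]] assms(3)
  by (simp add: proj_mult free_algebra_carrier)

lemma ideal_proj_add:
  assumes "ideal H (tensor_algebra V)" "proj p \<in> H" "proj r \<in> H" "p \<in> carrier FV" "r \<in> carrier FV"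
  shows "proj (p + r) \<in> H"
  using additive_subgroup.a_closed[OF ideal.axioms(1)[OF assms(1)] assms(2,3)] assms(4,5)
  by (simp add: proj_add)

lemma ideal_proj_sum:
  assumes "ideal H (tensor_algebra V)" and "\<And>i. i \<in> S \<Longrightarrow> proj (f i) \<in> H" "\<And>i. i \<in> S \<Longrightarrow> f i \<in> carrier FV"
  shows "proj (\<Sum>i\<in>S. f i) \<in> H"
  using assms(2,3)
proof (induction S rule: infinite_finite_induct)
  case (insert i S)
  then show ?case by (simp add: ideal_proj_add[OF assms(1)] free_algebra_carrier_sum)
qed (use additive_subgroup.zero_closed[OF ideal.axioms(1)[OF assms(1)]] in \<open>simp_all add: proj_zero\<close>)

end

section \<open>The cotangent space\<close>

instance pos_root :: finite
proof
  have "(UNIV :: pos_root set) = {Alpha1, Alpha2, Alpha12}"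
    using pos_root.exhaust by blast
  then show "finite (UNIV :: pos_root set)" by (metis finite.emptyI finite_insert)
qed

lemma tangent_space_zero_iff:
  assumes "linear_functional y"
  shows "(\<forall>X\<in>tangent_space q. y X = 0) \<longleftrightarrow> (\<forall>s. y (root_vec q s) = 0)"
proof
  assume *: "\<forall>X\<in>tangent_space q. y X = 0"
  have "root_vec q s \<in> tangent_space q" for s
    unfolding tangent_space_def
    by (rule CollectI, rule exI[of _ "\<lambda>\<gamma>. of_bool (s = Inl \<gamma>)"], rule exI[of _ "\<lambda>\<gamma>. of_bool (s = Inr \<gamma>)"])
      (cases s rule: tangent_index_cases; simp)
  with * show "\<forall>s. y (root_vec q s) = 0" by blast
next
  assume *: "\<forall>s. y (root_vec q s) = 0"
  have "y (root_E q \<gamma>) = 0" "y (root_F q \<gamma>) = 0" for \<gamma>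
    using *[rule_format, of "Inl \<gamma>"] *[rule_format, of "Inr \<gamma>"] by simp_all
  then show "\<forall>X\<in>tangent_space q. y X = 0"
    by (auto simp: tangent_space_def linear_functionalD[OF assms] simp del: root_E.simps)
qed

lemma counit_root_vec: "counit (root_vec q s) = 0"
  by (cases s rule: tangent_index_cases)
    (simp_all add: root_F_simple root_F_Alpha12 counit_mult linear_functionalD[OF linear_functional_counit])

context quantum_parameter
begin

abbreviation "ann_B \<equiv> tangent_annihilator q (Oq_F3 q)"
abbreviation "ann_A \<equiv> tangent_annihilator q (Oq_SU3 q)"
abbreviation "V1 \<equiv> cotangent_space q"

text \<open>The element of the cotangent space with coordinates \<open>c\<close>, as a coset of I in
  the augmentation ideal of B.\<close>

definition fibre :: "(tangent_index \<Rightarrow> complex) \<Rightarrow> functional set" where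
  "fibre c = {y \<in> Oq_F3 q. y 1 = 0 \<and> (\<forall>s. y (root_vec q s) = c s)}"

lemma Oq_SU3_linear: "a \<in> Oq_SU3 q \<Longrightarrow> linear_functional a"
  using coord_algebra_subset Uq_dual_linear by (auto simp: Oq_SU3_eq)

lemma Oq_F3_subset: "Oq_F3 q \<subseteq> Oq_SU3 q"
  by (auto simp: Oq_F3_def)

lemma ann_A_iff: "y \<in> ann_A \<longleftrightarrow> y \<in> Oq_SU3 q \<and> y 1 = 0 \<and> (\<forall>s. y (root_vec q s) = 0)"
  using tangent_space_zero_iff[OF Oq_SU3_linear] by (auto simp: tangent_annihilator_def augmentation_def)

lemma ann_B_eq_fibre: "ann_B = fibre (\<lambda>s. 0)"
  using tangent_space_zero_iff[OF Oq_SU3_linear] Oq_F3_subset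
  by (auto simp: tangent_annihilator_def augmentation_def fibre_def)

lemma Oq_SU3_lincomb:
  "a \<in> Oq_SU3 q \<Longrightarrow> b \<in> Oq_SU3 q \<Longrightarrow> (\<lambda>X. a X + c * b X) \<in> Oq_SU3 q"
  unfolding Oq_SU3_eq by (rule coord_algebra.add[OF _ coord_algebra.scale])

lemma Oq_F3_lincomb:
  assumes "a \<in> Oq_F3 q" "b \<in> Oq_F3 q"
  shows "(\<lambda>X. a X + c * b X) \<in> Oq_F3 q"
  using Oq_F3_add[OF assms(1) Oq_F3_scale[OF assms(2), of c]] by (simp add: plus_fun_def)

lemma fibre_lincomb:
  "a \<in> fibre f \<Longrightarrow> b \<in> fibre g \<Longrightarrow> (\<lambda>X. a X + c * b X) \<in> fibre (\<lambda>s. f s + c * g s)"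
  by (simp add: fibre_def Oq_F3_lincomb)

lemma dual_functional_fibre: "dual_functional s \<in> fibre (\<lambda>t. of_bool (s = t))"
  by (simp add: fibre_def dual_functional dual_functional_root_vec)

lemma zero_fibre: "(\<lambda>X. 0) \<in> fibre (\<lambda>s. 0)"
  using fibre_lincomb[OF dual_functional_fibre[of s] dual_functional_fibre[of s], of "-1" for s] by simp

text \<open>Here the dual functionals show that every coordinate vector occurs; they are added one
  coordinate at a time.\<close>

lemma fibre_nonempty: "fibre c \<noteq> {}"
proof -
  have "\<exists>y. y \<in> fibre (\<lambda>s. if s \<in> S then c s else 0)" for S
  proof (induction S rule: finite_induct[OF finite])
    case 1
    then show ?case using zero_fibre by auto
  next
    case (2 t S)
    then obtain y where "y \<in> fibre (\<lambda>s. if s \<in> S then c s else 0)" by blast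
    then have *: "(\<lambda>X. y X + c t * dual_functional t X) \<in> fibre (\<lambda>s. (if s \<in> S then c s else 0) + c t * of_bool (t = s))"
      by (rule fibre_lincomb[OF _ dual_functional_fibre])
    have "(\<lambda>s. (if s \<in> S then c s else 0) + c t * of_bool (t = s)) = (\<lambda>s. if s \<in> insert t S then c s else 0)"
      using 2 by auto
    with * show ?case by auto
  qed
  from this[of UNIV] show ?thesis by auto
qed

lemma fibre_inject: "fibre c = fibre d \<longleftrightarrow> c = d"
proof
  obtain y where "y \<in> fibre c" using fibre_nonempty by blast
  moreover assume "fibre c = fibre d"
  ultimately have "y \<in> fibre c" "y \<in> fibre d" by simp_all
  then show "c = d" by (auto simp: fibre_def)
qed simp

lemma fcoset_eq_fibre:
  assumes "b \<in> fibre c"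
  shows "fcoset b ann_B = fibre c"
proof
  show "fcoset b ann_B \<subseteq> fibre c"
    using fibre_lincomb[OF assms, of _ "\<lambda>s. 0" 1] by (auto simp: fcoset_def ann_B_eq_fibre)
  show "fibre c \<subseteq> fcoset b ann_B"
  proof
    fix y assume "y \<in> fibre c"
    then have "(\<lambda>X. y X + -1 * b X) \<in> ann_B"
      using fibre_lincomb[OF _ assms, of y c "-1"] by (simp add: ann_B_eq_fibre)
    then show "y \<in> fcoset b ann_B"
      unfolding fcoset_def by (intro CollectI exI[of _ "\<lambda>X. y X + -1 * b X"]) auto
  qed
qed

lemma carrier_V1: "carrier V1 = range fibre"
proof -
  have "fcoset b ann_B = fibre (\<lambda>s. b (root_vec q s))" if "b \<in> augmentation (Oq_F3 q)" for b
    using that by (intro fcoset_eq_fibre) (auto simp: fibre_def augmentation_def)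
  moreover have "\<exists>b\<in>augmentation (Oq_F3 q). fcoset b ann_B = fibre c" for c
    using fibre_nonempty[of c] fcoset_eq_fibre[of _ c] by (auto simp: fibre_def augmentation_def)
  ultimately show ?thesis
    by (fastforce simp: cotangent_space_def)
qed

lemma fibre_carrier: "fibre c \<in> carrier V1"
  by (simp add: carrier_V1)

lemma V1_add: "fibre c \<oplus>\<^bsub>V1\<^esub> fibre d = fibre (\<lambda>s. c s + d s)"
proof -
  have "y \<in> {\<lambda>X. a X + b X | a b. a \<in> fibre c \<and> b \<in> fibre d}" if y: "y \<in> fibre (\<lambda>s. c s + d s)" for y
  proof -
    \<comment> \<open>Any representative \<open>a\<close> will do: the difference of
      \<open>y\<close> and \<open>a\<close> has coordinates \<open>d\<close>.\<close>
    obtain a where a: "a \<in> fibre c" using fibre_nonempty by blast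
    have "(\<lambda>X. y X + -1 * a X) \<in> fibre d" using fibre_lincomb[OF y a, of "-1"] by simp
    with a show ?thesis
      by (intro CollectI exI[of _ a] exI[of _ "\<lambda>X. y X + -1 * a X"]) auto
  qed
  then show ?thesis
    using fibre_lincomb[of _ c _ d 1] by (auto simp: cotangent_space_def)
qed

lemma V1_smult: "k \<odot>\<^bsub>V1\<^esub> fibre c = fibre (\<lambda>s. k * c s)"
proof -
  have "y \<in> {\<lambda>X. k * a X + n X | a n. a \<in> fibre c \<and> n \<in> ann_B}" if y: "y \<in> fibre (\<lambda>s. k * c s)" for y
  proof -
    obtain a where a: "a \<in> fibre c" using fibre_nonempty by blast
    have "(\<lambda>X. y X + - k * a X) \<in> ann_B"
      using fibre_lincomb[OF y a, of "- k"] by (simp add: ann_B_eq_fibre)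
    with a show ?thesis
      by (intro CollectI exI[of _ a] exI[of _ "\<lambda>X. y X + - k * a X"]) auto
  qed
  moreover have "(\<lambda>X. k * a X + n X) \<in> fibre (\<lambda>s. k * c s)" if "a \<in> fibre c" "n \<in> ann_B" for a n
    using fibre_lincomb[of n "\<lambda>s. 0" a c k] that by (simp add: ann_B_eq_fibre add.commute)
  ultimately show ?thesis by (auto simp: cotangent_space_def)
qed

sublocale closed_operations V1
  by unfold_locales (auto simp: carrier_V1 V1_add V1_smult)

text \<open>An element of the augmentation ideal of B lies in the class of \<open>a\<close> exactly
  when it has the coordinates of \<open>a\<close>. Uniqueness rests on fibres being nonempty, since
  an empty set would lie in every class.\<close>

lemma cotangent_class_eq:
  assumes a: "a \<in> Oq_SU3 q" "a 1 = 0"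
  shows "cotangent_class q a = fibre (\<lambda>s. a (root_vec q s))"
  unfolding cotangent_class_def
proof (rule the_equality, intro conjI subsetI)
  fix y assume "y \<in> fibre (\<lambda>s. a (root_vec q s))"
  then have "(\<lambda>X. y X + -1 * a X) \<in> ann_A"
    using Oq_SU3_lincomb[of y a "-1"] a Oq_F3_subset by (auto simp: ann_A_iff fibre_def)
  then show "y \<in> fcoset a ann_A"
    unfolding fcoset_def by (intro CollectI exI[of _ "\<lambda>X. y X + -1 * a X"]) auto
next
  fix v assume "v \<in> carrier V1 \<and> v \<subseteq> fcoset a ann_A"
  moreover then obtain c where v: "v = fibre c" by (auto simp: carrier_V1)
  moreover obtain y where y: "y \<in> fibre c" using fibre_nonempty by blast
  ultimately obtain n where "n \<in> ann_A" "y = (\<lambda>X. a X + n X)" by (auto simp: fcoset_def)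
  then have "c = (\<lambda>s. a (root_vec q s))" using y by (auto simp: fibre_def ann_A_iff)
  then show "v = fibre (\<lambda>s. a (root_vec q s))" by (simp add: v)
qed (simp add: carrier_V1)

section \<open>Coordinates in the tensor algebra\<close>

definition bvec :: "tangent_index \<Rightarrow> functional set falg" where
  "bvec s = letter (fibre (\<lambda>t. of_bool (t = s)))"

lemma bvec_carrier: "bvec s \<in> carrier FV"
  by (simp add: bvec_def free_algebra_carrier carrier_V1)

lemma basis_eq_proj: "basis_e q \<gamma> = proj (bvec (Inl \<gamma>))" "basis_f q \<gamma> = proj (bvec (Inr \<gamma>))"
proof -
  \<comment> \<open>The descriptions of e and f differ only in \<open>P\<close>. Nonempty fibres
    keep the quantifier over \<open>v\<close> from being vacuous.\<close>
  have the: "(THE v. v \<in> carrier V1 \<and> (\<forall>y\<in>v. P y)) = fibre c"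
    if P: "\<And>y. y \<in> Oq_F3 q \<Longrightarrow> y 1 = 0 \<Longrightarrow> P y \<longleftrightarrow> y \<in> fibre c" for P c
  proof (rule the_equality)
    show "fibre c \<in> carrier V1 \<and> (\<forall>y\<in>fibre c. P y)"
      using P by (auto simp: carrier_V1 fibre_def)
    fix v assume v: "v \<in> carrier V1 \<and> (\<forall>y\<in>v. P y)"
    then obtain d where d: "v = fibre d" by (auto simp: carrier_V1)
    moreover obtain y where y: "y \<in> fibre d" using fibre_nonempty by blast
    ultimately have "P y" using v by blast
    then have "y \<in> fibre c" using P[of y] y by (auto simp: fibre_def)
    then show "v = fibre c" using y unfolding d fibre_inject by (auto simp: fibre_def)
  qed
  have all: "(\<forall>s. Q s) \<longleftrightarrow> (\<forall>\<delta>. Q (Inl \<delta>) \<and> Q (Inr \<delta>))" for Q :: "tangent_index \<Rightarrow> bool"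
    by (metis sum.exhaust)
  show "basis_e q \<gamma> = proj (bvec (Inl \<gamma>))" "basis_f q \<gamma> = proj (bvec (Inr \<gamma>))"
    unfolding basis_e_def basis_f_def tensor_vec_eq_proj bvec_def
    by (rule arg_cong[where f = proj], rule arg_cong[where f = letter], rule the, simp add: fibre_def all)+
qed

text \<open>Every vector is a letter of its own in the free algebra; the linearity relators
  decompose it into basis letters, one coordinate at a time.\<close>

lemma proj_letter_fibre: "proj (letter (fibre c)) = proj (\<Sum>s\<in>UNIV. scalar (c s) * bvec s)"
proof -
  have "proj (letter (fibre (\<lambda>s. if s \<in> S then c s else 0))) = proj (\<Sum>s\<in>S. scalar (c s) * bvec s)" for S
  proof (induction S rule: finite_induct[OF finite])
    case 1
    show ?case using proj_letter_smult[of "fibre (\<lambda>s. 0)" 0] by (simp add: V1_smult carrier_V1)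
  next
    case (2 t S)
    have "(\<lambda>s. if s \<in> insert t S then c s else 0) = (\<lambda>s. c t * of_bool (s = t) + (if s \<in> S then c s else 0))"
      using 2 by auto
    then have "fibre (\<lambda>s. if s \<in> insert t S then c s else 0)
        = (c t \<odot>\<^bsub>V1\<^esub> fibre (\<lambda>s. of_bool (s = t))) \<oplus>\<^bsub>V1\<^esub> fibre (\<lambda>s. if s \<in> S then c s else 0)"
      by (simp add: V1_add V1_smult)
    then have "proj (letter (fibre (\<lambda>s. if s \<in> insert t S then c s else 0)))
        = proj (letter (c t \<odot>\<^bsub>V1\<^esub> fibre (\<lambda>s. of_bool (s = t))) + letter (fibre (\<lambda>s. if s \<in> S then c s else 0)))"
      by (simp only:) (rule proj_letter_add, simp_all add: carrier_V1 V1_smult)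
    also have "\<dots> = proj (scalar (c t) * bvec t + (\<Sum>s\<in>S. scalar (c s) * bvec s))"
    proof (rule proj_add_cong)
      show "proj (letter (c t \<odot>\<^bsub>V1\<^esub> fibre (\<lambda>s. of_bool (s = t)))) = proj (scalar (c t) * bvec t)"
        unfolding bvec_def by (rule proj_letter_smult) (simp add: carrier_V1)
    qed (use 2 in \<open>auto simp: free_algebra_carrier fibre_carrier V1_smult bvec_carrier intro!: free_algebra_carrier_sum\<close>)
    finally show ?case using 2 by simp
  qed
  from this[of UNIV] show ?thesis by simp
qed

definition lincomb :: "functional \<Rightarrow> functional set falg" where
  "lincomb a = (\<Sum>s\<in>UNIV. scalar (a (root_vec q s)) * bvec s)"

lemma lincomb_carrier: "lincomb a \<in> carrier FV"
  unfolding lincomb_def by (intro free_algebra_carrier_sum free_algebra_carrier(2,5) bvec_carrier)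

text \<open>Passing to \<open>plus_part a\<close> does not change coordinates, because the counit
  vanishes on root vectors.\<close>

lemma tensor_vec_class:
  assumes "a \<in> Oq_SU3 q"
  shows "tensor_vec V1 (cotangent_class q (plus_part a)) = proj (lincomb a)"
proof -
  have "plus_part a = (\<lambda>X. a X + (- a 1) * counit X)" by (simp add: plus_part_def fun_eq_iff)
  then have "plus_part a \<in> Oq_SU3 q"
    using Oq_SU3_lincomb[OF assms, of counit "- a 1"] coord_algebra.counit by (simp add: Oq_SU3_eq)
  moreover have "plus_part a 1 = 0" "plus_part a (root_vec q s) = a (root_vec q s)" for s
    by (simp_all add: plus_part_def counit_root_vec)
  ultimately show ?thesis
    by (simp add: cotangent_class_eq tensor_vec_eq_proj proj_letter_fibre lincomb_def)
qed

definition quadratic :: "(tangent_index \<Rightarrow> tangent_index \<Rightarrow> complex) \<Rightarrow> functional set falg" where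
  "quadratic M = (\<Sum>s\<in>UNIV. \<Sum>t\<in>UNIV. scalar (M s t) * (bvec s * bvec t))"

lemma quadratic_carrier: "quadratic M \<in> carrier FV"
  unfolding quadratic_def by (intro free_algebra_carrier_sum free_algebra_carrier(2,5) bvec_carrier)

lemma lincomb_mult: "lincomb a * lincomb b = quadratic (\<lambda>s t. a (root_vec q s) * b (root_vec q t))"
proof -
  have "scalar c * x * (scalar d * y) = scalar (c * d) * (x * y)" for c d and x y :: "functional set falg"
    by (simp only: scalar_mult mult.assoc scalar_left_commute[of x d])
  then show ?thesis by (simp add: lincomb_def quadratic_def sum_product)
qed

lemma quadratic_add: "quadratic M + quadratic M' = quadratic (\<lambda>s t. M s t + M' s t)"
  by (simp add: quadratic_def scalar_add distrib_right sum.distrib)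

lemma class_tensor_eq:
  assumes "set bs \<subseteq> Oq_SU3 q \<times> Oq_SU3 q"
  shows "class_tensor q bs = proj (quadratic (\<lambda>s t. \<Sum>(a, b)\<leftarrow>bs. a (root_vec q s) * b (root_vec q t)))"
  using assms
proof (induction bs)
  case Nil
  show ?case by (simp add: class_tensor_def proj_zero quadratic_def)
next
  case (Cons ab bs)
  obtain a b where ab: "ab = (a, b)" by (cases ab)
  have "class_tensor q (ab # bs)
      = (proj (lincomb a) \<otimes>\<^bsub>TV q\<^esub> proj (lincomb b)) \<oplus>\<^bsub>TV q\<^esub> class_tensor q bs"
    using Cons.prems by (simp add: class_tensor_def ab tensor_vec_class)
  then show ?case
    using Cons by (simp add: ab proj_mult lincomb_carrier proj_add lincomb_mult quadratic_carrier quadratic_add)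
qed

text \<open>Whichever list represents the coproduct of \<open>y\<close>, its coefficients sum to
  values of \<open>y\<close> on products. A list exists because A is closed under the
  coproduct.\<close>

lemma degree_two_relators_eq:
  "degree_two_relators q = {proj (quadratic (\<lambda>s t. y (root_vec q s * root_vec q t))) | y. y \<in> ann_B}"
proof -
  have *: "class_tensor q bs = proj (quadratic (\<lambda>s t. y (root_vec q s * root_vec q t)))"
    if "set bs \<subseteq> Oq_SU3 q \<times> Oq_SU3 q" "is_coproduct y bs" for y bs
    using that by (simp add: class_tensor_eq is_coproduct_def)
  moreover have "\<exists>bs. set bs \<subseteq> Oq_SU3 q \<times> Oq_SU3 q \<and> is_coproduct y bs" if "y \<in> ann_B" for y
    using that coord_algebra_coproduct[of y q] Oq_F3_subset
    by (auto simp: ann_B_eq_fibre fibre_def Oq_SU3_eq)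
  ultimately show ?thesis
    unfolding degree_two_relators_def by (auto, metis)
qed

end

section \<open>Defining relations of the quantum exterior algebra\<close>

context quantum_parameter
begin

lemma leading_eq:
  "leading = {(Inl Alpha1, Inl Alpha1), (Inl Alpha1, Inl Alpha2), (Inl Alpha1, Inl Alpha12),
    (Inl Alpha2, Inl Alpha2), (Inl Alpha12, Inl Alpha2), (Inl Alpha12, Inl Alpha12),
    (Inr Alpha1, Inr Alpha1), (Inr Alpha1, Inr Alpha2), (Inr Alpha1, Inr Alpha12),
    (Inr Alpha2, Inr Alpha2), (Inr Alpha12, Inr Alpha2), (Inr Alpha12, Inr Alpha12),
    (Inl Alpha1, Inr Alpha1), (Inl Alpha1, Inr Alpha2), (Inl Alpha1, Inr Alpha12),
    (Inl Alpha2, Inr Alpha1), (Inl Alpha2, Inr Alpha2), (Inl Alpha2, Inr Alpha12),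
    (Inl Alpha12, Inr Alpha1), (Inl Alpha12, Inr Alpha2), (Inl Alpha12, Inr Alpha12)}" (is "_ = ?L")
proof
  show "leading \<subseteq> ?L"
  proof (rule subrelI)
    fix s t assume "(s, t) \<in> leading"
    then show "(s, t) \<in> ?L" by (cases rule: leading_cases) simp_all
  qed
  show "?L \<subseteq> leading" by (simp add: leading_def less_eq_pos_root_def)
qed

text \<open>The relation with all terms on one side, hence signs opposite to the listed ones. For
  \<open>s = t\<close> the first two terms meet in one entry, whose value is
  \<open>leading_coeff s s\<close>.\<close>

definition relator_coeff :: "tangent_index \<Rightarrow> tangent_index \<Rightarrow> tangent_index \<Rightarrow> tangent_index \<Rightarrow> complex" where
  "relator_coeff s t a b = of_bool (a = s \<and> b = t) + (case (s, t) of
      (Inl \<gamma>, Inl \<beta>) \<Rightarrow> qpow q (root_form \<beta> \<gamma>) * of_bool (a = t \<and> b = s)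
    | (Inr \<gamma>, Inr \<beta>) \<Rightarrow> qpow q (- root_form \<beta> \<gamma>) * of_bool (a = t \<and> b = s)
    | (Inl \<gamma>, Inr \<beta>) \<Rightarrow> qpow q (root_form \<beta> \<gamma>) * of_bool (a = t \<and> b = s)
        + nu q * (of_bool (\<beta> = Alpha1 \<and> \<gamma> = Alpha1) - of_bool (\<beta> = Alpha2 \<and> \<gamma> = Alpha2))
          * of_bool (a = Inr Alpha12 \<and> b = Inl Alpha12)
    | _ \<Rightarrow> 0)"

definition relator :: "tangent_index \<Rightarrow> tangent_index \<Rightarrow> functional set falg" where
  "relator s t = quadratic (relator_coeff s t)"

lemma relator_carrier: "relator s t \<in> carrier FV"
  by (simp add: relator_def quadratic_carrier)

lemma quadratic_scalar: "scalar c * quadratic M = quadratic (\<lambda>s t. c * M s t)"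
  by (simp add: quadratic_def sum_distrib_left scalar_mult mult.assoc)

lemma quadratic_diff: "quadratic M - quadratic M' = quadratic (\<lambda>s t. M s t - M' s t)"
  by (simp add: quadratic_def scalar_diff left_diff_distrib sum_subtractf)

lemma quadratic_sum:
  "finite S \<Longrightarrow> (\<Sum>i\<in>S. quadratic (M i)) = quadratic (\<lambda>s t. \<Sum>i\<in>S. M i s t)"
  by (induction S rule: finite_induct) (simp_all add: quadratic_add, simp add: quadratic_def)

lemma bvec_mult: "bvec a * bvec b = quadratic (\<lambda>s t. of_bool (s = a \<and> t = b))"
proof -
  have "scalar (of_bool P) * x = (if P then x else 0)" for P and x :: "functional set falg"
    by simp
  then have "(\<Sum>t\<in>UNIV. scalar (of_bool (s = a \<and> t = b)) * (bvec s * bvec t))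
      = (if s = a then bvec a * bvec b else 0)" for s
    by (cases "s = a") (simp_all add: sum.delta)
  then show ?thesis by (simp add: quadratic_def sum.delta)
qed

text \<open>Since \<open>q\<close> is real, 1 + q^2 is positive, so the diagonal relations can be
  normalised.\<close>

lemma leading_coeff_nonzero: "leading_coeff s t \<noteq> 0"
proof -
  have *: "1 + complex_of_real q ^ 2 \<noteq> 0"
  proof -
    have "1 + complex_of_real q ^ 2 = complex_of_real (1 + q ^ 2)" by simp
    moreover have "1 + q ^ 2 \<noteq> 0" by (metis add_pos_nonneg less_irrefl zero_le_power2 zero_less_one)
    ultimately show ?thesis by (simp only: of_real_eq_0_iff) simp
  qed
  then have "1 + inverse (complex_of_real q ^ 2) \<noteq> 0"
    by (simp add: field_simps add.commute)
  with * show ?thesis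
    by (auto simp: leading_coeff_def power_int_minus split: sum.split)
qed

text \<open>A relator meets the leading positions only in its own pair, which forces the
  coefficients. The assumptions say that the entries at the other positions then agree.\<close>

lemma quadratic_eq_relators:
  assumes "\<And>\<beta> \<gamma>. \<beta> < \<gamma> \<Longrightarrow> M (Inl \<beta>) (Inl \<gamma>) = qpow q (root_form \<beta> \<gamma>) * M (Inl \<gamma>) (Inl \<beta>)"
    and "\<And>\<beta> \<gamma>. \<beta> < \<gamma> \<Longrightarrow> M (Inr \<beta>) (Inr \<gamma>) = qpow q (- root_form \<beta> \<gamma>) * M (Inr \<gamma>) (Inr \<beta>)"
    and "\<And>\<beta> \<gamma>. M (Inr \<beta>) (Inl \<gamma>) = qpow q (root_form \<beta> \<gamma>) * M (Inl \<gamma>) (Inr \<beta>)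
      + (if \<beta> = Alpha12 \<and> \<gamma> = Alpha12 then nu q * (M (Inl Alpha1) (Inr Alpha1) - M (Inl Alpha2) (Inr Alpha2)) else 0)"
  shows "quadratic M = (\<Sum>(s, t)\<in>leading. scalar (M s t / leading_coeff s t) * relator s t)"
proof -
  have "M a b = (\<Sum>(s, t)\<in>leading. M s t / leading_coeff s t * relator_coeff s t a b)" for a b
  proof -
    have rel: "M (Inl Alpha2) (Inl Alpha12) = qpow q (root_form Alpha2 Alpha12) * M (Inl Alpha12) (Inl Alpha2)"
      "M (Inl Alpha2) (Inl Alpha1) = qpow q (root_form Alpha2 Alpha1) * M (Inl Alpha1) (Inl Alpha2)"
      "M (Inl Alpha12) (Inl Alpha1) = qpow q (root_form Alpha12 Alpha1) * M (Inl Alpha1) (Inl Alpha12)"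
      "M (Inr Alpha2) (Inr Alpha12) = qpow q (- root_form Alpha2 Alpha12) * M (Inr Alpha12) (Inr Alpha2)"
      "M (Inr Alpha2) (Inr Alpha1) = qpow q (- root_form Alpha2 Alpha1) * M (Inr Alpha1) (Inr Alpha2)"
      "M (Inr Alpha12) (Inr Alpha1) = qpow q (- root_form Alpha12 Alpha1) * M (Inr Alpha1) (Inr Alpha12)"
      by (intro assms(1,2), simp add: less_pos_root_def)+
    have rf: "root_form \<gamma> \<gamma> = 2" for \<gamma> by (cases \<gamma>) (simp_all add: root_form_def)
    have lc: "leading_coeff (Inl \<gamma>) (Inl \<gamma>) = 1 + qpow q 2" "leading_coeff (Inr \<gamma>) (Inr \<gamma>) = 1 + qpow q (-2)"
      "1 + qpow q 2 \<noteq> 0" "1 + qpow q (-2) \<noteq> 0" for \<gamma>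
      using leading_coeff_nonzero[of "Inl \<gamma>" "Inl \<gamma>"] leading_coeff_nonzero[of "Inr \<gamma>" "Inr \<gamma>"]
      by (simp_all add: leading_coeff_def)
    have lc': "s \<noteq> t \<Longrightarrow> leading_coeff s t = 1" for s t by (simp add: leading_coeff_def)
    show ?thesis
      unfolding leading_eq
      by (cases a rule: tangent_index_cases; cases b rule: tangent_index_cases; hypsubst)
        (simp_all add: relator_coeff_def rel assms(3) lc lc' rf del: power_int_numeral,
         simp_all add: algebra_simps)
  qed
  then have "quadratic M = quadratic (\<lambda>a b. \<Sum>(s, t)\<in>leading. M s t / leading_coeff s t * relator_coeff s t a b)"
    by (intro arg_cong[where f = quadratic] ext)
  also have "\<dots> = (\<Sum>(s, t)\<in>leading. scalar (M s t / leading_coeff s t) * relator s t)"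
    by (simp add: relator_def quadratic_scalar case_prod_unfold quadratic_sum)
  finally show ?thesis .
qed

lemma ann_B_quadratic:
  assumes "y \<in> ann_B"
  shows "quadratic (\<lambda>s t. y (root_vec q s * root_vec q t)) =
    (\<Sum>(s, t)\<in>leading. scalar (y (root_vec q s * root_vec q t) / leading_coeff s t) * relator s t)"
proof -
  have y: "y \<in> Oq_F3 q" "y 1 = 0" "\<And>s. y (root_vec q s) = 0"
    using assms by (auto simp: ann_B_eq_fibre fibre_def)
  show ?thesis
    by (rule quadratic_eq_relators) (rule annihilator_relations[OF y]; assumption)+
qed

lemma dual_product_ann_B: "(s, t) \<in> leading \<Longrightarrow> dual_product s t \<in> ann_B"
  by (simp add: ann_B_eq_fibre fibre_def dual_product_root_vec convolution_1 dual_functional Oq_F3_convolution)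

lemma ideals_eq:
  "Idl\<^bsub>TV q\<^esub> (degree_two_relators q) = Idl\<^bsub>TV q\<^esub> ((\<lambda>(s, t). proj (relator s t)) ` leading)"
    (is "Idl\<^bsub>_\<^esub> ?D = Idl\<^bsub>_\<^esub> ?R")
proof
  interpret TV: ring "TV q" by (rule ring_tensor_algebra)
  have D: "?D \<subseteq> carrier (TV q)"
    by (auto simp: degree_two_relators_eq intro: proj_closed quadratic_carrier)
  have R: "?R \<subseteq> carrier (TV q)"
    by (auto intro: proj_closed relator_carrier)
  note ideal_D = TV.genideal_ideal[OF D] and ideal_R = TV.genideal_ideal[OF R]
  have relator_R: "proj (relator s t) \<in> Idl\<^bsub>TV q\<^esub> ?R" if "(s, t) \<in> leading" for s t
    using TV.genideal_self[OF R] that by auto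
  show "Idl\<^bsub>TV q\<^esub> ?D \<subseteq> Idl\<^bsub>TV q\<^esub> ?R"
  proof (rule TV.genideal_minimal[OF ideal_R], rule subsetI)
    fix x assume "x \<in> ?D"
    then obtain y where "y \<in> ann_B" and x: "x = proj (quadratic (\<lambda>s t. y (root_vec q s * root_vec q t)))"
      by (auto simp: degree_two_relators_eq)
    then show "x \<in> Idl\<^bsub>TV q\<^esub> ?R"
      unfolding x ann_B_quadratic[OF \<open>y \<in> ann_B\<close>]
      by (intro ideal_proj_sum[OF ideal_R])
        (auto intro!: ideal_proj_smult[OF ideal_R] relator_R free_algebra_carrier relator_carrier)
  qed
  define H where "H = Idl\<^bsub>TV q\<^esub> ?D"
  \<comment> \<open>Row \<open>(s, t)\<close> holds the coefficients of a dual product with respect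
    to the relators: an identity matrix up to the column of \<open>?\<theta>\<close>.\<close>
  define c where "c s t s' t' = dual_product s t (root_vec q s' * root_vec q t') / leading_coeff s' t'" for s t s' t'
  have H: "ideal H (TV q)" unfolding H_def by (rule ideal_D)
  have in_H: "proj (\<Sum>(s', t')\<in>leading. scalar (c s t s' t') * relator s' t') \<in> H" if "(s, t) \<in> leading" for s t
    using TV.genideal_self[OF D] dual_product_ann_B[OF that] ann_B_quadratic[OF dual_product_ann_B[OF that]]
    unfolding c_def H_def by (auto simp: degree_two_relators_eq)
  have lead: "scalar (c s t s t) * relator s t = relator s t" if "(s, t) \<in> leading" for s t
    using that by (simp add: c_def dual_product_leading leading_coeff_nonzero)
  let ?\<theta> = "(Inl Alpha12, Inr Alpha12) :: tangent_index \<times> tangent_index"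
  have \<theta>: "?\<theta> \<in> leading" by (simp add: leading_def)
  have zero: "c s t s' t' = 0"
    if "(s, t) \<in> leading" "(s', t') \<in> leading" "(s, t) \<noteq> (s', t')" "(s', t') \<noteq> ?\<theta>" for s t s' t'
    using dual_product_leading_zero[OF that(1-3)] that(4) by (auto simp: c_def)
  have neutral: "(\<Sum>(s', t')\<in>S. scalar (c s t s' t') * relator s' t') = 0"
    if "\<And>s' t'. (s', t') \<in> S \<Longrightarrow> c s t s' t' = 0" for S s t
    using that by (intro sum.neutral) (auto simp: that)
  \<comment> \<open>The row of \<open>?\<theta>\<close> has only its diagonal entry, so this relator
    is obtained first and can be subtracted from all other rows.\<close>
  have "(\<Sum>(s', t')\<in>leading. scalar (c (Inl Alpha12) (Inr Alpha12) s' t') * relator s' t')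
      = relator (Inl Alpha12) (Inr Alpha12) + (\<Sum>(s', t')\<in>leading - {?\<theta>}. scalar (c (Inl Alpha12) (Inr Alpha12) s' t') * relator s' t')"
    using lead[OF \<theta>] by (simp add: sum.remove[OF finite \<theta>])
  also have "(\<Sum>(s', t')\<in>leading - {?\<theta>}. scalar (c (Inl Alpha12) (Inr Alpha12) s' t') * relator s' t') = 0"
    by (rule neutral) (rule zero[OF \<theta>]; auto)
  finally have \<theta>_H: "proj (relator (Inl Alpha12) (Inr Alpha12)) \<in> H"
    using in_H[OF \<theta>] by simp
  have "proj (relator s t) \<in> H" if st: "(s, t) \<in> leading" for s t
  proof (cases "(s, t) = ?\<theta>")
    case True
    then show ?thesis using \<theta>_H by simp
  next
    case False
    let ?k = "c s t (Inl Alpha12) (Inr Alpha12)"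
    have \<theta>': "?\<theta> \<in> leading - {(s, t)}" using \<theta> False by auto
    have "(\<Sum>(s', t')\<in>leading. scalar (c s t s' t') * relator s' t')
        = relator s t + (scalar ?k * relator (Inl Alpha12) (Inr Alpha12)
          + (\<Sum>(s', t')\<in>leading - {(s, t)} - {?\<theta>}. scalar (c s t s' t') * relator s' t'))"
      using lead[OF st] by (simp add: sum.remove[OF finite st] sum.remove[OF finite \<theta>'])
    also have "(\<Sum>(s', t')\<in>leading - {(s, t)} - {?\<theta>}. scalar (c s t s' t') * relator s' t') = 0"
      by (rule neutral) (rule zero[OF st]; auto)
    finally have "proj (relator s t + scalar ?k * relator (Inl Alpha12) (Inr Alpha12)) \<in> H"
      using in_H[OF st] by simp
    then have "proj (relator s t + scalar ?k * relator (Inl Alpha12) (Inr Alpha12) + scalar (- ?k) * relator (Inl Alpha12) (Inr Alpha12)) \<in> H"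
      by (rule ideal_proj_add[OF H _ ideal_proj_smult[OF H \<theta>_H relator_carrier]])
        (intro free_algebra_carrier(2,4,5) relator_carrier)+
    then show ?thesis by (simp add: scalar_uminus)
  qed
  then show "Idl\<^bsub>TV q\<^esub> ?R \<subseteq> Idl\<^bsub>TV q\<^esub> ?D"
    unfolding H_def by (intro TV.genideal_minimal[OF ideal_D]) auto
qed

lemma relations_eq:
  "(\<lambda>(s, t). proj (relator s t)) ` leading =
      {basis_e q \<gamma> \<otimes>\<^bsub>TV q\<^esub> basis_e q \<beta> \<ominus>\<^bsub>TV q\<^esub>
         TV_smult q (- qpow q (root_form \<beta> \<gamma>)) (basis_e q \<beta> \<otimes>\<^bsub>TV q\<^esub> basis_e q \<gamma>)
         | \<beta> \<gamma>. \<beta> \<le> \<gamma>} \<union>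
      {basis_f q \<gamma> \<otimes>\<^bsub>TV q\<^esub> basis_f q \<beta> \<ominus>\<^bsub>TV q\<^esub>
         TV_smult q (- qpow q (- root_form \<beta> \<gamma>)) (basis_f q \<beta> \<otimes>\<^bsub>TV q\<^esub> basis_f q \<gamma>)
         | \<beta> \<gamma>. \<beta> \<le> \<gamma>} \<union>
      {basis_e q \<gamma> \<otimes>\<^bsub>TV q\<^esub> basis_f q \<beta> \<ominus>\<^bsub>TV q\<^esub>
         TV_smult q (- qpow q (root_form \<beta> \<gamma>)) (basis_f q \<beta> \<otimes>\<^bsub>TV q\<^esub> basis_e q \<gamma>)
         | \<beta> \<gamma>. \<beta> \<noteq> \<gamma> \<or> (\<beta> = Alpha12 \<and> \<gamma> = Alpha12)} \<union>
      {basis_e q Alpha1 \<otimes>\<^bsub>TV q\<^esub> basis_f q Alpha1 \<ominus>\<^bsub>TV q\<^esub>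
         (TV_smult q (- qpow q 2) (basis_f q Alpha1 \<otimes>\<^bsub>TV q\<^esub> basis_e q Alpha1) \<oplus>\<^bsub>TV q\<^esub>
          TV_smult q (- nu q) (basis_f q Alpha12 \<otimes>\<^bsub>TV q\<^esub> basis_e q Alpha12)),
       basis_e q Alpha2 \<otimes>\<^bsub>TV q\<^esub> basis_f q Alpha2 \<ominus>\<^bsub>TV q\<^esub>
         (TV_smult q (- qpow q 2) (basis_f q Alpha2 \<otimes>\<^bsub>TV q\<^esub> basis_e q Alpha2) \<oplus>\<^bsub>TV q\<^esub>
          TV_smult q (nu q) (basis_f q Alpha12 \<otimes>\<^bsub>TV q\<^esub> basis_e q Alpha12))}"
proof -
  note simps = basis_eq_proj proj_mult proj_smult proj_minus proj_add bvec_carrier free_algebra_carrier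
    bvec_mult quadratic_scalar quadratic_diff quadratic_add quadratic_carrier
  have ee: "basis_e q \<gamma> \<otimes>\<^bsub>TV q\<^esub> basis_e q \<beta> \<ominus>\<^bsub>TV q\<^esub>
      TV_smult q (- qpow q (root_form \<beta> \<gamma>)) (basis_e q \<beta> \<otimes>\<^bsub>TV q\<^esub> basis_e q \<gamma>)
    = proj (relator (Inl \<gamma>) (Inl \<beta>))" for \<beta> \<gamma>
    by (simp add: simps relator_def relator_coeff_def[abs_def])
  have ff: "basis_f q \<gamma> \<otimes>\<^bsub>TV q\<^esub> basis_f q \<beta> \<ominus>\<^bsub>TV q\<^esub>
      TV_smult q (- qpow q (- root_form \<beta> \<gamma>)) (basis_f q \<beta> \<otimes>\<^bsub>TV q\<^esub> basis_f q \<gamma>)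
    = proj (relator (Inr \<gamma>) (Inr \<beta>))" for \<beta> \<gamma>
    by (simp add: simps relator_def relator_coeff_def[abs_def])
  have ef: "basis_e q \<gamma> \<otimes>\<^bsub>TV q\<^esub> basis_f q \<beta> \<ominus>\<^bsub>TV q\<^esub>
      TV_smult q (- qpow q (root_form \<beta> \<gamma>)) (basis_f q \<beta> \<otimes>\<^bsub>TV q\<^esub> basis_e q \<gamma>)
    = proj (relator (Inl \<gamma>) (Inr \<beta>))" if "\<beta> \<noteq> \<gamma> \<or> (\<beta> = Alpha12 \<and> \<gamma> = Alpha12)" for \<beta> \<gamma>
  proof -
    have "relator_coeff (Inl \<gamma>) (Inr \<beta>)
        = (\<lambda>a b. of_bool (a = Inl \<gamma> \<and> b = Inr \<beta>) + qpow q (root_form \<beta> \<gamma>) * of_bool (a = Inr \<beta> \<and> b = Inl \<gamma>))"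
      using that by (auto simp: relator_coeff_def fun_eq_iff)
    then show ?thesis by (simp add: simps relator_def)
  qed
  have rf: "root_form Alpha1 Alpha1 = 2" "root_form Alpha2 Alpha2 = 2" by (simp_all add: root_form_def)
  have ef1: "basis_e q Alpha1 \<otimes>\<^bsub>TV q\<^esub> basis_f q Alpha1 \<ominus>\<^bsub>TV q\<^esub>
         (TV_smult q (- qpow q 2) (basis_f q Alpha1 \<otimes>\<^bsub>TV q\<^esub> basis_e q Alpha1) \<oplus>\<^bsub>TV q\<^esub>
          TV_smult q (- nu q) (basis_f q Alpha12 \<otimes>\<^bsub>TV q\<^esub> basis_e q Alpha12))
    = proj (relator (Inl Alpha1) (Inr Alpha1))"
    by (simp add: simps relator_def relator_coeff_def[abs_def] rf algebra_simps)
  have ef2: "basis_e q Alpha2 \<otimes>\<^bsub>TV q\<^esub> basis_f q Alpha2 \<ominus>\<^bsub>TV q\<^esub>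
         (TV_smult q (- qpow q 2) (basis_f q Alpha2 \<otimes>\<^bsub>TV q\<^esub> basis_e q Alpha2) \<oplus>\<^bsub>TV q\<^esub>
          TV_smult q (nu q) (basis_f q Alpha12 \<otimes>\<^bsub>TV q\<^esub> basis_e q Alpha12))
    = proj (relator (Inl Alpha2) (Inr Alpha2))"
    by (simp add: simps relator_def relator_coeff_def[abs_def] rf algebra_simps)
  let ?ef = "{basis_e q \<gamma> \<otimes>\<^bsub>TV q\<^esub> basis_f q \<beta> \<ominus>\<^bsub>TV q\<^esub>
         TV_smult q (- qpow q (root_form \<beta> \<gamma>)) (basis_f q \<beta> \<otimes>\<^bsub>TV q\<^esub> basis_e q \<gamma>)
         | \<beta> \<gamma>. \<beta> \<noteq> \<gamma> \<or> (\<beta> = Alpha12 \<and> \<gamma> = Alpha12)}"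
  have ef_set: "?ef = {proj (relator (Inl \<gamma>) (Inr \<beta>)) | \<beta> \<gamma>. \<beta> \<noteq> \<gamma> \<or> (\<beta> = Alpha12 \<and> \<gamma> = Alpha12)}"
    using ef by (intro Collect_cong) metis
  have "(\<lambda>(s, t). proj (relator s t)) ` leading =
      {proj (relator (Inl \<gamma>) (Inl \<beta>)) | \<beta> \<gamma>. \<beta> \<le> \<gamma>} \<union> {proj (relator (Inr \<gamma>) (Inr \<beta>)) | \<beta> \<gamma>. \<beta> \<le> \<gamma>} \<union>
      {proj (relator (Inl \<gamma>) (Inr \<beta>)) | \<beta> \<gamma>. True}"
    by (fastforce simp: leading_def image_iff)
  \<comment> \<open>The diagonal pairs at the simple roots carry the extra term with \<nu> and are
    therefore split off.\<close>
  also have "{proj (relator (Inl \<gamma>) (Inr \<beta>)) | \<beta> \<gamma>. True} =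
      {proj (relator (Inl \<gamma>) (Inr \<beta>)) | \<beta> \<gamma>. \<beta> \<noteq> \<gamma> \<or> (\<beta> = Alpha12 \<and> \<gamma> = Alpha12)} \<union>
      {proj (relator (Inl Alpha1) (Inr Alpha1)), proj (relator (Inl Alpha2) (Inr Alpha2))}" (is "_ = ?mixed")
  proof -
    have "proj (relator (Inl \<gamma>) (Inr \<beta>)) \<in> ?mixed" for \<beta> \<gamma>
    proof (cases "\<beta> \<noteq> \<gamma> \<or> (\<beta> = Alpha12 \<and> \<gamma> = Alpha12)")
      case False
      then have "\<beta> = \<gamma>" "\<gamma> = Alpha1 \<or> \<gamma> = Alpha2" by (cases \<gamma>; auto)+
      then show ?thesis by blast
    qed blast
    then show ?thesis by blast
  qed
  finally show ?thesis
    by (simp only: ee ff ef_set ef1 ef2 Un_assoc)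
qed

end

theorem theorem3p7:
  fixes q :: real
  assumes "q \<notin> {-1, 0, 1}"
  shows "quantum_exterior_algebra q = TV q Quot (Idl\<^bsub>TV q\<^esub> (
      {basis_e q \<gamma> \<otimes>\<^bsub>TV q\<^esub> basis_e q \<beta> \<ominus>\<^bsub>TV q\<^esub>
         TV_smult q (- qpow q (root_form \<beta> \<gamma>)) (basis_e q \<beta> \<otimes>\<^bsub>TV q\<^esub> basis_e q \<gamma>)
         | \<beta> \<gamma>. \<beta> \<le> \<gamma>} \<union>
      {basis_f q \<gamma> \<otimes>\<^bsub>TV q\<^esub> basis_f q \<beta> \<ominus>\<^bsub>TV q\<^esub>
         TV_smult q (- qpow q (- root_form \<beta> \<gamma>)) (basis_f q \<beta> \<otimes>\<^bsub>TV q\<^esub> basis_f q \<gamma>)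
         | \<beta> \<gamma>. \<beta> \<le> \<gamma>} \<union>
      {basis_e q \<gamma> \<otimes>\<^bsub>TV q\<^esub> basis_f q \<beta> \<ominus>\<^bsub>TV q\<^esub>
         TV_smult q (- qpow q (root_form \<beta> \<gamma>)) (basis_f q \<beta> \<otimes>\<^bsub>TV q\<^esub> basis_e q \<gamma>)
         | \<beta> \<gamma>. \<beta> \<noteq> \<gamma> \<or> (\<beta> = Alpha12 \<and> \<gamma> = Alpha12)} \<union>
      {basis_e q Alpha1 \<otimes>\<^bsub>TV q\<^esub> basis_f q Alpha1 \<ominus>\<^bsub>TV q\<^esub>
         (TV_smult q (- qpow q 2) (basis_f q Alpha1 \<otimes>\<^bsub>TV q\<^esub> basis_e q Alpha1) \<oplus>\<^bsub>TV q\<^esub>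
          TV_smult q (- nu q) (basis_f q Alpha12 \<otimes>\<^bsub>TV q\<^esub> basis_e q Alpha12)),
       basis_e q Alpha2 \<otimes>\<^bsub>TV q\<^esub> basis_f q Alpha2 \<ominus>\<^bsub>TV q\<^esub>
         (TV_smult q (- qpow q 2) (basis_f q Alpha2 \<otimes>\<^bsub>TV q\<^esub> basis_e q Alpha2) \<oplus>\<^bsub>TV q\<^esub>
          TV_smult q (nu q) (basis_f q Alpha12 \<otimes>\<^bsub>TV q\<^esub> basis_e q Alpha12))}))"
proof -
  interpret quantum_parameter q by unfold_locales (rule assms)
  show ?thesis
    by (simp only: quantum_exterior_algebra_def ideals_eq relations_eq)
qed

end
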